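(* Let $d\ge2$, let $V:\mathbb R^d\to[0,+\infty)$ be continuously differentiable, and let $\mathcal V(\mu)=\int_{\mathbb R^d}V(x)\,d\mu(x)$ for $\mu\in\mathcal P_2(\mathbb R^d)$. Then for every discrete probability measure $\mu^n=\sum_{i=1}^nm_i\delta_{x_i}$ on $\mathbb R^d$, $$|\partial\mathcal V|_{SW}(\mu^n)=\sqrt d\,|\partial\mathcal V|_W(\mu^n).$$
   Context: $\mathcal P_2(\mathbb R^d)$ is the set of Borel probability measures on $\mathbb R^d$ with finite second moment, $W$ the quadratic Wasserstein distance, $\sigma$ the uniform probability measure on $\mathbb S^{d-1}$. For $\theta\in\mathbb S^{d-1}$, $\hat\mu^\theta$ is the pushforward of $\mu$ under $x\mapsto x\cdot\theta$, and $SW^2(\mu,\nu)=\int_{\mathbb S^{d-1}}W^2(\hat\mu^\theta,\hat\nu^\theta)\,d\sigma(\theta)$. Metric slope of $\mathcal E$ with respect to a metric $m$: $|\partial\mathcal E|_m(u)=\limsup_{v\to u\text{ in }m}\frac{[\mathcal E(u)-\mathcal E(v)]_+}{m(u,v)}$ (the value $\mathcal E(v)=+\infty$ is allowed and contributes $0$). *)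

theory Defs
  imports "HOL-Probability.Probability"
begin

definition P2 :: "'a::euclidean_space measure set" where
  "P2 = {\<mu>. prob_space \<mu> \<and> sets \<mu> = sets borel \<and> (\<integral>\<^sup>+ x. ennreal ((norm x)\<^sup>2) \<partial>\<mu>) < \<infinity>}"

definition couplings ::
    "'a::euclidean_space measure \<Rightarrow> 'a measure \<Rightarrow> ('a \<times> 'a) measure set" where
  "couplings \<mu> \<nu> = {\<gamma>. prob_space \<gamma> \<and> sets \<gamma> = sets borel \<and>
      distr \<gamma> borel fst = \<mu> \<and> distr \<gamma> borel snd = \<nu>}"

definition transport_cost ::
    "'a::euclidean_space measure \<Rightarrow> 'a measure \<Rightarrow> ennreal" where
  "transport_cost \<mu> \<nu> =
     (INF \<gamma>\<in>couplings \<mu> \<nu>. \<integral>\<^sup>+ z. ennreal ((dist (fst z) (snd z))\<^sup>2) \<partial>\<gamma>)"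

text \<open>The real-valued distance is only meaningful where the cost is finite, in particular on
  \<^const>\<open>P2\<close> (lemma \<open>transport_cost_finite\<close> below).\<close>

definition wasserstein :: "'a::euclidean_space measure \<Rightarrow> 'a measure \<Rightarrow> real" where
  "wasserstein \<mu> \<nu> = sqrt (enn2real (transport_cost \<mu> \<nu>))"

text \<open>The uniform probability measure on the unit sphere, as a Borel measure on the ambient space:
  the radial projection of the normalised Lebesgue measure on the unit ball. The value
  \<open>sgn 0 = 0\<close> is irrelevant, being attained on a null set.\<close>

definition uniform_sphere :: "'a::euclidean_space measure" where
  "uniform_sphere = distr (uniform_measure lborel (ball 0 1)) borel sgn"

definition projection :: "'a::euclidean_space \<Rightarrow> 'a measure \<Rightarrow> real measure" where
  "projection \<theta> \<mu> = distr \<mu> borel (\<lambda>x. x \<bullet> \<theta>)"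

definition sliced_wasserstein :: "'a::euclidean_space measure \<Rightarrow> 'a measure \<Rightarrow> real" where
  "sliced_wasserstein \<mu> \<nu> =
     sqrt (enn2real (\<integral>\<^sup>+ \<theta>. ennreal ((wasserstein (projection \<theta> \<mu>) (projection \<theta> \<nu>))\<^sup>2)
       \<partial>uniform_sphere))"

text \<open>The slope at \<open>u\<close> of a functional \<open>E\<close> on the metric space \<open>(X, m)\<close>. The filter expresses
  \<open>v \<rightarrow> u\<close> with \<open>v \<in> X\<close> and \<open>m u v > 0\<close>. The conditional is needed because \<open>\<infinity> - \<infinity> = \<infinity>\<close> in
  \<^typ>\<open>ereal\<close>.\<close>

definition metric_slope ::
    "'x set \<Rightarrow> ('x \<Rightarrow> 'x \<Rightarrow> real) \<Rightarrow> ('x \<Rightarrow> ereal) \<Rightarrow> 'x \<Rightarrow> ennreal" where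
  "metric_slope X m E u =
     Limsup (inf (filtercomap (m u) (at_right 0)) (principal X))
       (\<lambda>v. (if E v = \<infinity> then 0 else e2ennreal (max 0 (E u - E v))) / ennreal (m u v))"

definition potential_energy :: "('a::euclidean_space \<Rightarrow> real) \<Rightarrow> 'a measure \<Rightarrow> ereal" where
  "potential_energy V \<mu> = enn2ereal (\<integral>\<^sup>+ x. ennreal (V x) \<partial>\<mu>)"

definition continuously_differentiable :: "('a::euclidean_space \<Rightarrow> real) \<Rightarrow> bool" where
  "continuously_differentiable V \<longleftrightarrow>
     (\<exists>V' :: 'a \<Rightarrow> 'a \<Rightarrow>\<^sub>L real.
        (\<forall>x. (V has_derivative blinfun_apply (V' x)) (at x)) \<and> continuous_on UNIV V')"

text \<open>The measure \<open>\<Sum>i=1..n. m i * \<delta>(x i)\<close>, see \<open>emeasure_discrete_measure\<close>.\<close>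

definition discrete_measure ::
    "nat \<Rightarrow> (nat \<Rightarrow> real) \<Rightarrow> (nat \<Rightarrow> 'a::euclidean_space) \<Rightarrow> 'a measure" where
  "discrete_measure n m x = distr (point_measure {1..n} (\<lambda>i. ennreal (m i))) borel x"

lemma sets_discrete_measure [simp]: "sets (discrete_measure n m x) = sets borel"
  by (simp add: discrete_measure_def)

lemma emeasure_discrete_measure:
  assumes "A \<in> sets borel"
  shows "emeasure (discrete_measure n m x) A =
    (\<Sum>i=1..n. ennreal (m i) * emeasure (return borel (x i)) A)"
proof -
  have "emeasure (discrete_measure n m x) A
      = emeasure (point_measure {1..n} (\<lambda>i. ennreal (m i))) {i\<in>{1..n}. x i \<in> A}"
    using assms unfolding discrete_measure_def
    by (subst emeasure_distr) (auto simp: space_point_measure intro!: arg_cong2[where f = emeasure])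
  also have "\<dots> = (\<Sum>i\<in>{i\<in>{1..n}. x i \<in> A}. ennreal (m i))"
    by (subst emeasure_point_measure_finite) auto
  also have "\<dots> = (\<Sum>i=1..n. if x i \<in> A then ennreal (m i) else 0)"
    by (subst sum.inter_filter) auto
  also have "\<dots> = (\<Sum>i=1..n. ennreal (m i) * emeasure (return borel (x i)) A)"
    using assms by (intro sum.cong) (auto simp: emeasure_return)
  finally show ?thesis .
qed

lemma nn_integral_discrete_measure:
  assumes "f \<in> borel_measurable borel"
  shows "(\<integral>\<^sup>+ y. f y \<partial>discrete_measure n m x) = (\<Sum>i=1..n. f (x i) * ennreal (m i))"
  using assms unfolding discrete_measure_def
  by (subst nn_integral_distr) (auto simp: nn_integral_point_measure_finite mult.commute)

lemma discrete_measure_in_P2: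
  assumes "\<And>i. i \<in> {1..n} \<Longrightarrow> 0 \<le> m i" and "(\<Sum>i=1..n. m i) = 1"
  shows "discrete_measure n m x \<in> P2"
proof -
  have "(\<Sum>i=1..n. ennreal (m i)) = 1"
    using assms by (subst sum_ennreal) auto
  then have "emeasure (discrete_measure n m x) UNIV = 1"
    by (simp add: emeasure_discrete_measure emeasure_return)
  then have "prob_space (discrete_measure n m x)"
    by (intro prob_spaceI) (simp add: discrete_measure_def)
  then show ?thesis
    by (auto simp: P2_def nn_integral_discrete_measure ennreal_mult_eq_top_iff less_top[symmetric])
qed

lemma product_in_couplings:
  assumes "\<mu> \<in> P2" "\<nu> \<in> P2"
  shows "\<mu> \<Otimes>\<^sub>M \<nu> \<in> couplings \<mu> \<nu>"
proof -
  interpret \<mu>: prob_space \<mu> using assms by (simp add: P2_def)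
  interpret \<nu>: prob_space \<nu> using assms by (simp add: P2_def)
  interpret pair_prob_space \<mu> \<nu> ..
  have s: "sets \<mu> = sets borel" "sets \<nu> = sets borel" using assms by (auto simp: P2_def)
  have sp: "space \<mu> = UNIV" "space \<nu> = UNIV" using s by (auto dest: sets_eq_imp_space_eq)
  have sets: "sets (\<mu> \<Otimes>\<^sub>M \<nu>) = sets borel"
    using sets_pair_measure_cong[OF s] by (metis borel_prod)
  have "distr (\<mu> \<Otimes>\<^sub>M \<nu>) borel fst = \<mu>"
  proof (rule measure_eqI)
    fix A assume "A \<in> sets (distr (\<mu> \<Otimes>\<^sub>M \<nu>) borel fst)"
    then have A: "A \<in> sets borel" by simp
    have "emeasure (distr (\<mu> \<Otimes>\<^sub>M \<nu>) borel fst) A = emeasure (\<mu> \<Otimes>\<^sub>M \<nu>) (A \<times> UNIV)"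
      using A sets by (subst emeasure_distr)
        (auto simp: measurable_cong_sets[OF sets refl] space_pair_measure sp
          intro!: arg_cong2[where f = emeasure] measurable_fst'' borel_measurable_continuous_onI
            continuous_intros)
    also have "\<dots> = emeasure \<mu> A"
      using A s sp \<nu>.emeasure_space_1 by (subst \<nu>.emeasure_pair_measure_Times) auto
    finally show "emeasure (distr (\<mu> \<Otimes>\<^sub>M \<nu>) borel fst) A = emeasure \<mu> A" .
  qed (simp add: s)
  moreover have "distr (\<mu> \<Otimes>\<^sub>M \<nu>) borel snd = \<nu>"
  proof (rule measure_eqI)
    fix A assume "A \<in> sets (distr (\<mu> \<Otimes>\<^sub>M \<nu>) borel snd)"
    then have A: "A \<in> sets borel" by simp
    have "emeasure (distr (\<mu> \<Otimes>\<^sub>M \<nu>) borel snd) A = emeasure (\<mu> \<Otimes>\<^sub>M \<nu>) (UNIV \<times> A)"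
      using A sets by (subst emeasure_distr)
        (auto simp: measurable_cong_sets[OF sets refl] space_pair_measure sp
          intro!: arg_cong2[where f = emeasure] borel_measurable_continuous_onI
            continuous_intros)
    also have "\<dots> = emeasure \<nu> A"
      using A s sp \<mu>.emeasure_space_1 by (subst \<nu>.emeasure_pair_measure_Times) auto
    finally show "emeasure (distr (\<mu> \<Otimes>\<^sub>M \<nu>) borel snd) A = emeasure \<nu> A" .
  qed (simp add: s)
  ultimately show ?thesis
    using sets P.prob_space_axioms by (simp add: couplings_def prob_space_axioms)
qed

lemma transport_cost_finite:
  assumes "\<mu> \<in> P2" "\<nu> \<in> P2"
  shows "transport_cost \<mu> \<nu> < \<infinity>"
proof -
  interpret \<mu>: prob_space \<mu> using assms by (simp add: P2_def)
  interpret \<nu>: prob_space \<nu> using assms by (simp add: P2_def)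
  interpret pair_prob_space \<mu> \<nu> ..
  let ?\<gamma> = "\<mu> \<Otimes>\<^sub>M \<nu>"
  have \<gamma>: "?\<gamma> \<in> couplings \<mu> \<nu>" by (rule product_in_couplings[OF assms])
  then have sets: "sets ?\<gamma> = sets borel" by (simp add: couplings_def)
  have fm: "fst \<in> ?\<gamma> \<rightarrow>\<^sub>M borel" "snd \<in> ?\<gamma> \<rightarrow>\<^sub>M borel"
    by (auto simp: measurable_cong_sets[OF sets refl] intro!: borel_measurable_continuous_onI
         continuous_intros)
  have "(\<integral>\<^sup>+ z. ennreal ((dist (fst z) (snd z))\<^sup>2) \<partial>?\<gamma>)
      \<le> (\<integral>\<^sup>+ z. 2 * ennreal ((norm (fst z))\<^sup>2) + 2 * ennreal ((norm (snd z))\<^sup>2) \<partial>?\<gamma>)"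
  proof (rule nn_integral_mono)
    fix z :: "'a \<times> 'a"
    have "(dist (fst z) (snd z))\<^sup>2 \<le> (norm (fst z) + norm (snd z))\<^sup>2"
      by (intro power_mono) (auto simp: dist_norm norm_triangle_ineq4)
    also have "\<dots> \<le> 2 * (norm (fst z))\<^sup>2 + 2 * (norm (snd z))\<^sup>2"
      using sum_squares_bound[of "norm (fst z)" "norm (snd z)"] by (simp add: power2_sum)
    finally have "ennreal ((dist (fst z) (snd z))\<^sup>2)
        \<le> ennreal (2 * (norm (fst z))\<^sup>2 + 2 * (norm (snd z))\<^sup>2)"
      by (rule ennreal_leI)
    then show "ennreal ((dist (fst z) (snd z))\<^sup>2)
        \<le> 2 * ennreal ((norm (fst z))\<^sup>2) + 2 * ennreal ((norm (snd z))\<^sup>2)"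
      by (simp add: ennreal_plus ennreal_mult)
  qed
  also have "\<dots> = 2 * (\<integral>\<^sup>+ z. ennreal ((norm (fst z))\<^sup>2) \<partial>?\<gamma>)
      + 2 * (\<integral>\<^sup>+ z. ennreal ((norm (snd z))\<^sup>2) \<partial>?\<gamma>)"
    using fm by (subst nn_integral_add) (auto simp: nn_integral_cmult)
  also have "(\<integral>\<^sup>+ z. ennreal ((norm (fst z))\<^sup>2) \<partial>?\<gamma>)
      = (\<integral>\<^sup>+ x. ennreal ((norm x)\<^sup>2) \<partial>distr ?\<gamma> borel fst)"
    using fm by (subst nn_integral_distr) auto
  also have "(\<integral>\<^sup>+ z. ennreal ((norm (snd z))\<^sup>2) \<partial>?\<gamma>)
      = (\<integral>\<^sup>+ x. ennreal ((norm x)\<^sup>2) \<partial>distr ?\<gamma> borel snd)"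
    using fm by (subst nn_integral_distr) auto
  also have "2 * (\<integral>\<^sup>+ x. ennreal ((norm x)\<^sup>2) \<partial>distr ?\<gamma> borel fst)
      + 2 * (\<integral>\<^sup>+ x. ennreal ((norm x)\<^sup>2) \<partial>distr ?\<gamma> borel snd) < \<infinity>"
    using \<gamma> assms by (auto simp: couplings_def P2_def ennreal_mult_less_top)
  finally show ?thesis
    unfolding transport_cost_def using \<gamma> by (meson INF_lower le_less_trans)
qed

lemma sets_uniform_sphere [simp]: "sets uniform_sphere = sets borel"
  by (simp add: uniform_sphere_def)

lemma borel_measurable_sgn_euclidean [measurable]:
  "(sgn :: 'a::euclidean_space \<Rightarrow> 'a) \<in> borel_measurable borel"
  unfolding sgn_div_norm by measurable

lemma ball_lborel:
  "emeasure lborel (ball (0::'a::euclidean_space) 1) \<noteq> 0"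
  "emeasure lborel (ball (0::'a::euclidean_space) 1) \<noteq> \<infinity>"
  using content_ball_pos[of 1 "0::'a"] emeasure_lborel_ball_finite[of "0::'a" 1]
  by (auto simp: measure_def)

lemma prob_space_uniform_sphere: "prob_space (uniform_sphere :: 'a::euclidean_space measure)"
  unfolding uniform_sphere_def
  by (intro prob_space.prob_space_distr prob_space_uniform_measure ball_lborel) auto

lemma AE_uniform_sphere: "AE \<theta> in (uniform_sphere :: 'a::euclidean_space measure). \<theta> \<in> sphere 0 1"
proof -
  have "AE x in lborel. x \<noteq> (0::'a)"
    by (rule AE_I[where N = "{0}"]) auto
  then have "AE x in uniform_measure lborel (ball (0::'a) 1). x \<noteq> 0"
    by (intro AE_uniform_measureI) auto
  then have "AE x in uniform_measure lborel (ball (0::'a) 1). sgn x \<in> sphere 0 1"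
    by eventually_elim (simp add: norm_sgn)
  then show ?thesis
    unfolding uniform_sphere_def by (subst AE_distr_iff) auto
qed

lemma uniform_sphere_rotation_invariant:
  fixes T :: "real ^ 'd::{finite,wellorder} \<Rightarrow> real ^ 'd::{finite,wellorder}"
  assumes T: "orthogonal_transformation T"
  shows "distr uniform_sphere borel T = uniform_sphere"
proof (rule measure_eqI)
  have Tm [measurable]: "T \<in> borel_measurable borel"
    using T by (intro borel_measurable_continuous_onI linear_continuous_on)
      (simp add: orthogonal_transformation_linear linear_conv_bounded_linear[symmetric])
  fix A assume "A \<in> sets (distr uniform_sphere borel T)"
  then have A [measurable]: "A \<in> sets borel" by simp
  have sgnT: "sgn (T x) = T (sgn x)" for x
    using T by (simp add: sgn_div_norm orthogonal_transformation_norm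
      linear_cmul orthogonal_transformation_linear)
  define S where "S = ball 0 1 \<inter> sgn -` A"
  define S' where "S' = ball 0 1 \<inter> sgn -` (T -` A)"
  have Sb: "S \<in> sets borel" "S' \<in> sets borel"
    unfolding S_def S'_def
    using measurable_sets[OF borel_measurable_sgn_euclidean A]
      measurable_sets[OF measurable_comp[OF borel_measurable_sgn_euclidean Tm] A]
    by (auto simp: vimage_comp)
  have TS: "T ` S' = S"
  proof -
    have "T -` S = S'"
      using T by (auto simp: S_def S'_def sgnT orthogonal_transformation_norm)
    moreover have "surj T" using T by (rule orthogonal_transformation_surj)
    ultimately show ?thesis by (metis surj_image_vimage_eq)
  qed
  have S'l: "S' \<in> lmeasurable"
    by (rule bounded_set_imp_lmeasurable) (use Sb in \<open>auto simp: S'_def bounded_Int\<close>)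
  have Sl: "S \<in> lmeasurable"
    by (rule bounded_set_imp_lmeasurable) (use Sb in \<open>auto simp: S_def bounded_Int\<close>)
  have "measure lebesgue S = measure lebesgue S'"
    using measure_orthogonal_image[OF T S'l] TS by simp
  then have "emeasure lebesgue S = emeasure lebesgue S'"
    using emeasure_eq_measure2[OF Sl] emeasure_eq_measure2[OF S'l] by simp
  then have "emeasure lborel S = emeasure lborel S'"
    using Sb by (simp add: emeasure_completion main_part_sets)
  then show "emeasure (distr uniform_sphere borel T) A = emeasure uniform_sphere A"
    using measurable_sets[OF Tm A] measurable_sets[OF borel_measurable_sgn_euclidean A]
      measurable_sets[OF borel_measurable_sgn_euclidean measurable_sets[OF Tm A, simplified]]
    by (simp add: uniform_sphere_def emeasure_distr S_def S'_def)
qed simp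

end

theory Submission
  imports Defs
begin

text \<open>
  Let \<open>X\<close> be the support of \<open>\<mu> = \<mu>\<^sup>n\<close> and \<open>S\<^sup>2 = \<integral> |\<nabla>V|\<^sup>2 d\<mu>\<close>. The slope is \<open>S\<close> for \<open>W\<close> and \<open>\<surd>d S\<close>
  for \<open>SW\<close>.

  Lower bounds: transport each atom along \<open>-t \<nabla>V\<close>. The energy \<open>E\<close> decreases by \<open>t S\<^sup>2 + o(t)\<close>, while
  \<open>W \<le> t S\<close> and \<open>SW \<le> W / \<surd>d\<close>, the latter because \<open>\<theta> \<bullet> v\<close> has second moment \<open>|v|\<^sup>2 / d\<close> on the sphere.

  Upper bounds: it suffices to show \<open>E(\<mu>) - E(\<nu>) \<le> \<surd>d S s + o(s)\<close> for \<open>s = SW(\<mu>, \<nu>)\<close>. Fix a small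
  \<open>r\<close>. Outside a set of directions \<open>\<theta>\<close> of small measure, the projections of the points of \<open>X\<close> are
  \<open>2r\<close>-separated, so that for \<open>y\<close> in the ball \<open>B(z, r)\<close>, \<open>z \<in> X\<close>, the nearest projected atom to
  \<open>y \<bullet> \<theta>\<close> is \<open>z \<bullet> \<theta>\<close>. Hence \<open>W\<^sup>2\<close> of the projections dominates \<open>\<Sum>z. \<integral>\<^bsub>B(z, r)\<^esub> ((y - z) \<bullet> \<theta>)\<^sup>2 d\<nu>(y)\<close>, and
  averaging over \<open>\<theta>\<close> gives \<open>\<Sum>z. \<integral>\<^bsub>B(z, r)\<^esub> |y - z|\<^sup>2 d\<nu>(y) \<le> (1 + \<epsilon>) d s\<^sup>2\<close>. In the same way the mass of
  \<open>\<nu>\<close> outside the balls and the differences \<open>\<nu>(B(z, r)) - \<mu>{z}\<close> are \<open>O(s\<^sup>2)\<close>, hence negligible since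
  \<open>V \<ge> 0\<close>. In the balls \<open>V(y) \<ge> V(z) - (|\<nabla>V(z)| + \<eta>) |y - z|\<close>, and Young's inequality concludes.
\<close>

subsection \<open>The uniform measure on the sphere\<close>

text \<open>Such a map commutes with \<open>sgn\<close> and preserves the unit ball, so invariance
  of Lebesgue measure passes to its radial projection. Invariance of \<open>lborel\<close> is a
  hypothesis because the maps used below are coordinate reflections and swaps, for which it can be
  checked directly in every Euclidean space.\<close>

lemma uniform_sphere_invariant:
  fixes T :: "'a::euclidean_space \<Rightarrow> 'a"
  assumes "linear T" and norm: "\<And>x. norm (T x) = norm x"
    and lborel: "distr lborel borel T = lborel"
  shows "distr uniform_sphere borel T = uniform_sphere"
proof (rule measure_eqI)
  have Tm [measurable]: "T \<in> borel_measurable borel"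
    using assms(1) by (intro borel_measurable_continuous_onI linear_continuous_on)
      (simp add: linear_conv_bounded_linear)
  have sgnT: "sgn (T x) = T (sgn x)" for x
    using assms(1) by (simp add: sgn_div_norm norm linear_cmul)
  fix A assume "A \<in> sets (distr uniform_sphere borel T)"
  then have A [measurable]: "A \<in> sets borel" by simp
  have "emeasure lborel (ball 0 1 \<inter> {x. T (sgn x) \<in> A})
      = emeasure (distr lborel borel T) (ball 0 1 \<inter> {x. sgn x \<in> A})"
    by (subst emeasure_distr) (auto simp: sgnT norm intro!: arg_cong2[where f = emeasure])
  then show "emeasure (distr uniform_sphere borel T) A = emeasure uniform_sphere A"
    unfolding lborel by (simp add: uniform_sphere_def emeasure_distr vimage_def)
qed simp

text \<open>The reflection is a diagonal map with entries 1 and -1, so its Jacobian has absolute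
  value 1.\<close>

lemma lborel_distr_reflect_coordinate:
  fixes b :: "'a::euclidean_space"
  assumes b: "b \<in> Basis"
  shows "distr lborel borel (\<lambda>x. x - (2 * (x \<bullet> b)) *\<^sub>R b) = lborel"
proof -
  let ?c = "\<lambda>j. if j = b then - 1 else 1 :: real"
  have eq: "x - (2 * (x \<bullet> b)) *\<^sub>R b = 0 + (\<Sum>j\<in>Basis. (?c j * (x \<bullet> j)) *\<^sub>R j)" for x
    by (rule euclidean_eqI) (use b in \<open>auto simp: inner_simps inner_not_same_Basis\<close>)
  have "lborel = density (distr lborel borel (\<lambda>x. 0 + (\<Sum>j\<in>Basis. (?c j * (x \<bullet> j)) *\<^sub>R j)))
      (\<lambda>_. (\<Prod>j\<in>Basis. \<bar>?c j\<bar>))"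
    by (rule lborel_affine_euclidean) auto
  also have "(\<Prod>j\<in>Basis. \<bar>?c j\<bar>) = 1"
    by (intro prod.neutral) auto
  finally show ?thesis
    unfolding eq by (simp add: density_1)
qed

text \<open>Boxes determine \<open>lborel\<close>. As \<open>\<pi>\<close> is an involution, the
  preimage of a box is the box with permuted corners, which has the same side lengths up to
  order.\<close>

lemma lborel_distr_swap_coordinates:
  fixes b c :: "'a::euclidean_space"
  assumes b: "b \<in> Basis" "c \<in> Basis"
  defines "\<pi> \<equiv> \<lambda>j. if j = b then c else if j = c then b else j"
  shows "distr lborel borel (\<lambda>x. \<Sum>j\<in>Basis. (x \<bullet> \<pi> j) *\<^sub>R j) = lborel"
proof (rule lborel_eqI[symmetric])
  let ?T = "\<lambda>x::'a. \<Sum>j\<in>Basis. (x \<bullet> \<pi> j) *\<^sub>R j"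
  have \<pi>B: "\<pi> j \<in> Basis \<longleftrightarrow> j \<in> Basis" for j
    using b by (auto simp: \<pi>_def)
  have \<pi>\<pi>: "\<pi> (\<pi> j) = j" for j by (simp add: \<pi>_def)
  have bij: "bij_betw \<pi> Basis Basis"
    by (rule bij_betw_byWitness[where f' = \<pi>]) (auto simp: \<pi>\<pi> \<pi>B)
  fix l u :: 'a
  assume lu: "\<And>b. b \<in> Basis \<Longrightarrow> l \<bullet> b \<le> u \<bullet> b"
  have [measurable]: "?T \<in> borel_measurable borel" by measurable
  have vim: "?T -` box l u = box (?T l) (?T u)"
  proof (rule set_eqI)
    fix x
    have "x \<in> ?T -` box l u \<longleftrightarrow> (\<forall>j\<in>Basis. l \<bullet> j < x \<bullet> \<pi> j \<and> x \<bullet> \<pi> j < u \<bullet> j)"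
      by (simp add: mem_box)
    also have "\<dots> \<longleftrightarrow> (\<forall>j\<in>Basis. l \<bullet> \<pi> j < x \<bullet> j \<and> x \<bullet> j < u \<bullet> \<pi> j)"
      using \<pi>B \<pi>\<pi> by metis
    also have "\<dots> \<longleftrightarrow> x \<in> box (?T l) (?T u)"
      by (simp add: mem_box)
    finally show "x \<in> ?T -` box l u \<longleftrightarrow> x \<in> box (?T l) (?T u)" .
  qed
  have "emeasure (distr lborel borel ?T) (box l u) = emeasure lborel (box (?T l) (?T u))"
    by (simp add: emeasure_distr vim)
  also have "\<dots> = ennreal (\<Prod>j\<in>Basis. (u - l) \<bullet> \<pi> j)"
    using lu \<pi>B by (subst emeasure_lborel_box) (auto simp: inner_diff_left intro!: prod.cong)
  also have "(\<Prod>j\<in>Basis. (u - l) \<bullet> \<pi> j) = (\<Prod>j\<in>Basis. (u - l) \<bullet> j)"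
    using prod.reindex_bij_betw[OF bij, of "\<lambda>j. (u - l) \<bullet> j"] .
  finally show "emeasure (distr lborel borel ?T) (box l u) = (\<Prod>j\<in>Basis. (u - l) \<bullet> j)" .
qed simp

lemma uniform_sphere_integrable_coordinates:
  fixes b c :: "'a::euclidean_space"
  shows "integrable uniform_sphere (\<lambda>\<theta>. (\<theta> \<bullet> b) * (\<theta> \<bullet> c))"
proof -
  interpret prob_space "uniform_sphere :: 'a measure" by (rule prob_space_uniform_sphere)
  show ?thesis
  proof (rule integrable_const_bound[where B = "norm b * norm c"])
    show "AE \<theta> in uniform_sphere. norm ((\<theta> \<bullet> b) * (\<theta> \<bullet> c)) \<le> norm b * norm c"
      using AE_uniform_sphere
    proof eventually_elim
      case (elim \<theta>)
      then have "\<bar>\<theta> \<bullet> b\<bar> \<le> norm b" "\<bar>\<theta> \<bullet> c\<bar> \<le> norm c"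
        using Cauchy_Schwarz_ineq2[of \<theta> b] Cauchy_Schwarz_ineq2[of \<theta> c] by auto
      then show ?case by (auto simp: abs_mult intro!: mult_mono)
    qed
  qed (simp add: measurable_cong_sets[OF sets_uniform_sphere refl])
qed

text \<open>Reflecting the coordinate \<open>b\<close> preserves the measure and changes the sign of
  the integrand.\<close>

lemma uniform_sphere_coordinates_orthogonal:
  fixes b c :: "'a::euclidean_space"
  assumes "b \<in> Basis" "c \<in> Basis" "b \<noteq> c"
  shows "(\<integral>\<theta>. (\<theta> \<bullet> b) * (\<theta> \<bullet> c) \<partial>uniform_sphere) = 0"
proof -
  let ?T = "\<lambda>x::'a. x - (2 * (x \<bullet> b)) *\<^sub>R b"
  have T: "distr uniform_sphere borel ?T = uniform_sphere"
  proof (rule uniform_sphere_invariant)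
    show "linear ?T" by (auto intro!: linearI simp: inner_simps algebra_simps)
    show "norm (?T x) = norm x" for x
      using assms by (simp add: norm_eq inner_simps inner_commute algebra_simps)
  qed (rule lborel_distr_reflect_coordinate[OF assms(1)])
  have "(\<integral>\<theta>. (\<theta> \<bullet> b) * (\<theta> \<bullet> c) \<partial>uniform_sphere)
      = (\<integral>\<theta>. (\<theta> \<bullet> b) * (\<theta> \<bullet> c) \<partial>distr uniform_sphere borel ?T)"
    by (simp add: T)
  also have "\<dots> = (\<integral>\<theta>. - ((\<theta> \<bullet> b) * (\<theta> \<bullet> c)) \<partial>uniform_sphere)"
    using assms by (subst integral_distr)
      (auto simp: inner_simps inner_not_same_Basis measurable_cong_sets[OF sets_uniform_sphere refl])
  finally show ?thesis by simp
qed

text \<open>The swap of the two coordinates preserves the measure and carries one integrand into the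
  other.\<close>

lemma uniform_sphere_coordinates_equal:
  fixes b c :: "'a::euclidean_space"
  assumes "b \<in> Basis" "c \<in> Basis"
  shows "(\<integral>\<theta>. (\<theta> \<bullet> b) * (\<theta> \<bullet> b) \<partial>uniform_sphere) = (\<integral>\<theta>. (\<theta> \<bullet> c) * (\<theta> \<bullet> c) \<partial>uniform_sphere)"
proof -
  let ?\<pi> = "\<lambda>j. if j = b then c else if j = c then b else j"
  let ?T = "\<lambda>x::'a. \<Sum>j\<in>Basis. (x \<bullet> ?\<pi> j) *\<^sub>R j"
  have bij: "bij_betw ?\<pi> Basis Basis"
    by (rule bij_betw_byWitness[where f' = ?\<pi>]) (use assms in auto)
  have T: "distr uniform_sphere borel ?T = uniform_sphere"
  proof (rule uniform_sphere_invariant)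
    show "linear ?T"
      by (auto intro!: linearI simp: inner_simps scaleR_add_left sum.distrib scaleR_sum_right)
    fix x
    have "(norm (?T x))\<^sup>2 = (\<Sum>j\<in>Basis. (x \<bullet> ?\<pi> j)\<^sup>2)"
      by (subst euclidean_dist_l2[where y=0 and x = "?T x", unfolded dist_norm diff_0_right])
        (simp add: L2_set_def sum_nonneg)
    also have "\<dots> = (\<Sum>j\<in>Basis. (x \<bullet> j)\<^sup>2)"
      by (rule sum.reindex_bij_betw[OF bij])
    also have "\<dots> = (norm x)\<^sup>2"
      by (subst euclidean_dist_l2[where y=0 and x = x, unfolded dist_norm diff_0_right])
        (simp add: L2_set_def sum_nonneg)
    finally show "norm (?T x) = norm x" by simp
  qed (rule lborel_distr_swap_coordinates[OF assms])
  have "(\<integral>\<theta>. (\<theta> \<bullet> b) * (\<theta> \<bullet> b) \<partial>uniform_sphere)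
      = (\<integral>\<theta>. (\<theta> \<bullet> b) * (\<theta> \<bullet> b) \<partial>distr uniform_sphere borel ?T)"
    by (simp add: T)
  also have "\<dots> = (\<integral>\<theta>. (\<theta> \<bullet> c) * (\<theta> \<bullet> c) \<partial>uniform_sphere)"
    using assms by (subst integral_distr)
      (auto simp: measurable_cong_sets[OF sets_uniform_sphere refl])
  finally show ?thesis .
qed

text \<open>In the coordinate expansion of \<open>(v \<bullet> \<theta>)^2\<close> the mixed terms
  integrate to zero. The diagonal moments are equal and add up to 1, because \<open>\<theta>\<close>
  is almost surely a unit vector; hence each is \<open>1 / DIM('a)\<close>. This is the source of
  the factor \<open>sqrt d\<close>.\<close>

lemma uniform_sphere_second_moment:
  fixes v :: "'a::euclidean_space"
  shows "(\<integral>\<^sup>+\<theta>. ennreal ((v \<bullet> \<theta>)\<^sup>2) \<partial>uniform_sphere) = ennreal ((norm v)\<^sup>2 / DIM('a))"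
proof -
  interpret prob_space "uniform_sphere :: 'a measure" by (rule prob_space_uniform_sphere)
  note int = uniform_sphere_integrable_coordinates
  have one: "(\<integral>\<theta>. (\<theta> \<bullet> b) * (\<theta> \<bullet> b) \<partial>uniform_sphere) = 1 / DIM('a)" if b: "b \<in> Basis" for b :: 'a
  proof -
    have "DIM('a) * (\<integral>\<theta>. (\<theta> \<bullet> b) * (\<theta> \<bullet> b) \<partial>uniform_sphere)
        = (\<Sum>c\<in>(Basis::'a set). \<integral>\<theta>. (\<theta> \<bullet> c) * (\<theta> \<bullet> c) \<partial>uniform_sphere)"
      by (subst sum.cong[OF refl uniform_sphere_coordinates_equal[OF _ b]]) auto
    also have "\<dots> = (\<integral>\<theta>. (\<Sum>c\<in>(Basis::'a set). (\<theta> \<bullet> c) * (\<theta> \<bullet> c)) \<partial>uniform_sphere)"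
      by (rule Bochner_Integration.integral_sum[symmetric]) (rule int)
    also have "\<dots> = (\<integral>\<theta>. 1 \<partial>(uniform_sphere :: 'a measure))"
    proof (rule integral_cong_AE)
      show "AE \<theta> in uniform_sphere. (\<Sum>c\<in>(Basis::'a set). (\<theta> \<bullet> c) * (\<theta> \<bullet> c)) = 1"
        using AE_uniform_sphere
        by eventually_elim (simp add: euclidean_inner[symmetric] norm_eq_1)
    qed (auto simp: measurable_cong_sets[OF sets_uniform_sphere refl])
    also have "\<dots> = 1" by (simp add: prob_space)
    finally show ?thesis by (simp add: field_simps)
  qed
  have sq: "(v \<bullet> \<theta>)\<^sup>2 = (\<Sum>b\<in>Basis. \<Sum>c\<in>Basis. ((v \<bullet> b) * (v \<bullet> c)) * ((\<theta> \<bullet> b) * (\<theta> \<bullet> c)))" for \<theta>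
    by (subst euclidean_inner) (simp add: power2_eq_square sum_product algebra_simps)
  have intv: "integrable uniform_sphere (\<lambda>\<theta>. (v \<bullet> \<theta>)\<^sup>2)"
    unfolding sq by (intro Bochner_Integration.integrable_sum integrable_mult_right int)
  have "(\<integral>\<theta>. (v \<bullet> \<theta>)\<^sup>2 \<partial>uniform_sphere)
      = (\<Sum>b\<in>Basis. \<Sum>c\<in>Basis. ((v \<bullet> b) * (v \<bullet> c)) *
          (\<integral>\<theta>. (\<theta> \<bullet> b) * (\<theta> \<bullet> c) \<partial>uniform_sphere))"
    unfolding sq by (simp add: Bochner_Integration.integral_sum int integrable_mult_right)
  also have "\<dots> = (\<Sum>b\<in>Basis. ((v \<bullet> b) * (v \<bullet> b)) * (1 / DIM('a)))"
  proof (rule sum.cong)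
    fix b :: 'a assume b: "b \<in> Basis"
    have "(\<Sum>c\<in>Basis. ((v \<bullet> b) * (v \<bullet> c)) * (\<integral>\<theta>. (\<theta> \<bullet> b) * (\<theta> \<bullet> c) \<partial>uniform_sphere))
        = (\<Sum>c\<in>Basis. if b = c then ((v \<bullet> b) * (v \<bullet> b)) * (1 / DIM('a)) else 0)"
      using b by (intro sum.cong) (auto simp: one uniform_sphere_coordinates_orthogonal)
    then show "(\<Sum>c\<in>Basis. ((v \<bullet> b) * (v \<bullet> c)) * (\<integral>\<theta>. (\<theta> \<bullet> b) * (\<theta> \<bullet> c) \<partial>uniform_sphere))
        = ((v \<bullet> b) * (v \<bullet> b)) * (1 / DIM('a))"
      using b by simp
  qed simp
  also have "\<dots> = (norm v)\<^sup>2 / DIM('a)"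
    by (simp add: power2_norm_eq_inner euclidean_inner[of v v] sum_divide_distrib)
  finally show ?thesis
    using intv by (subst nn_integral_eq_integral) auto
qed

section \<open>Thin slabs around hyperplanes\<close>

text \<open>A linear hyperplane is a cone: it contains \<open>sgn x\<close> exactly when it contains
  \<open>x\<close>. So the claim reduces to hyperplanes being Lebesgue null.\<close>

lemma uniform_sphere_hyperplane:
  fixes u :: "'a::euclidean_space"
  assumes "u \<noteq> 0"
  shows "emeasure uniform_sphere {\<theta>. u \<bullet> \<theta> = 0} = 0"
proof -
  have "{x. u \<bullet> x = 0} \<in> null_sets lborel"
    using negligible_hyperplane[of u 0] assms
    by (simp add: negligible_iff_null_sets null_sets_completion_iff closed_hyperplane borel_closed)
  then have "emeasure lborel (ball 0 1 \<inter> {x. u \<bullet> x = 0}) = 0"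
    using emeasure_eq_0[OF null_setsD2 null_setsD1 inf_le2] by blast
  moreover have "u \<bullet> sgn x = 0 \<longleftrightarrow> u \<bullet> x = 0" for x
    by (auto simp: sgn_div_norm)
  ultimately show ?thesis
    by (simp add: uniform_sphere_def emeasure_distr vimage_def borel_closed closed_hyperplane)
qed

text \<open>Continuity from above along the slabs of half-width \<open>1 / Suc k\<close>, which
  decrease to a null hyperplane.\<close>

lemma uniform_sphere_small_slab:
  fixes u :: "'a::euclidean_space"
  assumes "u \<noteq> 0" "\<epsilon> > 0"
  shows "\<exists>\<delta>>0. measure uniform_sphere {\<theta>. \<bar>u \<bullet> \<theta>\<bar> < \<delta>} < \<epsilon>"
proof -
  interpret prob_space "uniform_sphere :: 'a measure" by (rule prob_space_uniform_sphere)
  let ?A = "\<lambda>k. {\<theta>. \<bar>u \<bullet> \<theta>\<bar> < 1 / real (Suc k)}"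
  have "(\<lambda>k. measure uniform_sphere (?A k)) \<longlonglongrightarrow> measure uniform_sphere (\<Inter>k. ?A k)"
  proof (rule finite_Lim_measure_decseq)
    show "decseq ?A"
      by (intro antimonoI Collect_mono) (auto simp: frac_le elim!: less_le_trans)
  qed auto
  also have "(\<Inter>k. ?A k) = {\<theta>. u \<bullet> \<theta> = 0}"
  proof safe
    fix \<theta> assume "\<theta> \<in> (\<Inter>k. ?A k)"
    then have *: "\<bar>u \<bullet> \<theta>\<bar> < 1 / real (Suc k)" for k by auto
    show "u \<bullet> \<theta> = 0"
    proof (rule ccontr)
      assume "u \<bullet> \<theta> \<noteq> 0"
      then obtain k where "inverse (real (Suc k)) < \<bar>u \<bullet> \<theta>\<bar>"
        using reals_Archimedean[of "\<bar>u \<bullet> \<theta>\<bar>"] by auto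
      then show False using *[of k] by (simp add: inverse_eq_divide)
    qed
  qed auto
  finally have "(\<lambda>k. measure uniform_sphere (?A k)) \<longlonglongrightarrow> 0"
    by (simp add: measure_def uniform_sphere_hyperplane[OF assms(1)])
  then have "\<forall>\<^sub>F k in sequentially. measure uniform_sphere (?A k) < \<epsilon>"
    using assms(2) by (rule order_tendstoD)
  then obtain k where "measure uniform_sphere (?A k) < \<epsilon>"
    by (auto simp: eventually_sequentially)
  then show ?thesis by (intro exI[of _ "1 / real (Suc k)"]) auto
qed

text \<open>Compactness makes the width independent of the direction: scaling reduces to unit
  \<open>u\<close>, and if \<open>u\<close> is within \<open>h v / 2\<close> of \<open>v\<close>,
  the slab of \<open>u\<close> lies in that of \<open>v\<close> up to a null set. For
  \<open>u = 0\<close> the strict inequality makes the slab empty.\<close>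

lemma uniform_sphere_small_slab_uniform:
  assumes "\<epsilon> > 0"
  shows "\<exists>\<delta>>0. \<forall>u::'a::euclidean_space.
    measure uniform_sphere {\<theta>. \<bar>u \<bullet> \<theta>\<bar> < \<delta> * norm u} \<le> \<epsilon>"
proof -
  interpret prob_space "uniform_sphere :: 'a measure" by (rule prob_space_uniform_sphere)
  have "\<forall>u\<in>sphere (0::'a) 1. \<exists>\<delta>>0. measure uniform_sphere {\<theta>. \<bar>u \<bullet> \<theta>\<bar> < \<delta>} < \<epsilon>"
    using assms by (auto intro!: uniform_sphere_small_slab)
  then obtain h where h: "\<And>u. u \<in> sphere (0::'a) 1 \<Longrightarrow> h u > 0"
    "\<And>u. u \<in> sphere (0::'a) 1 \<Longrightarrow> measure uniform_sphere {\<theta>. \<bar>u \<bullet> \<theta>\<bar> < h u} < \<epsilon>"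
    by metis
  obtain C where C: "C \<subseteq> sphere (0::'a) 1" "finite C"
    and cover: "sphere 0 1 \<subseteq> (\<Union>u\<in>C. ball u (h u / 2))"
  proof (rule compactE_image[of "sphere (0::'a) 1" "sphere (0::'a) 1" "\<lambda>u. ball u (h u / 2)"])
    show "sphere (0::'a) 1 \<subseteq> (\<Union>u\<in>sphere 0 1. ball u (h u / 2))"
      using h(1) by (meson UN_I centre_in_ball half_gt_zero subsetI)
  qed auto
  obtain \<delta> where \<delta>: "\<delta> > 0" "\<And>u. u \<in> C \<Longrightarrow> \<delta> \<le> h u / 2"
  proof (cases "C = {}")
    case False
    show thesis
    proof (rule that[of "Min ((\<lambda>u. h u / 2) ` C)"])
      show "Min ((\<lambda>u. h u / 2) ` C) \<le> h u / 2" if "u \<in> C" for u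
        using that C by (intro Min_le) auto
    qed (use False C h(1) in \<open>auto simp: subset_eq\<close>)
  qed (auto intro: that[of 1])
  have unit: "measure uniform_sphere {\<theta>. \<bar>u \<bullet> \<theta>\<bar> < \<delta>} \<le> \<epsilon>" if u: "norm u = 1" for u :: 'a
  proof -
    obtain v where v: "v \<in> C" "dist v u < h v / 2"
      using subsetD[OF cover, of u] u by auto
    have "AE \<theta> in uniform_sphere. \<theta> \<in> {\<theta>. \<bar>u \<bullet> \<theta>\<bar> < \<delta>} \<longrightarrow> \<theta> \<in> {\<theta>. \<bar>v \<bullet> \<theta>\<bar> < h v}"
      using AE_uniform_sphere
    proof eventually_elim
      case (elim \<theta>)
      have "\<bar>(v - u) \<bullet> \<theta>\<bar> \<le> dist v u"
        using Cauchy_Schwarz_ineq2[of "v - u" \<theta>] elim by (simp add: dist_norm)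
      then show ?case
        using v(2) \<delta>(2)[OF v(1)] by (auto simp: inner_diff_left)
    qed
    then have "measure uniform_sphere {\<theta>. \<bar>u \<bullet> \<theta>\<bar> < \<delta>} \<le> measure uniform_sphere {\<theta>. \<bar>v \<bullet> \<theta>\<bar> < h v}"
      by (intro finite_measure_mono_AE) auto
    with h(2)[of v] v(1) C show ?thesis by auto
  qed
  have "measure uniform_sphere {\<theta>. \<bar>u \<bullet> \<theta>\<bar> < \<delta> * norm u} \<le> \<epsilon>" for u :: 'a
  proof (cases "u = 0")
    case False
    then have "{\<theta>. \<bar>u \<bullet> \<theta>\<bar> < \<delta> * norm u} = {\<theta>. \<bar>sgn u \<bullet> \<theta>\<bar> < \<delta>}"
      by (auto simp: sgn_div_norm abs_mult field_simps)
    then show ?thesis using unit[of "sgn u"] False by (simp add: norm_sgn)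
  qed (use assms in simp)
  then show ?thesis using \<delta>(1) by blast
qed

subsection \<open>Weak duality and projections\<close>

lemma space_P2: "\<mu> \<in> P2 \<Longrightarrow> space \<mu> = UNIV"
  by (auto simp: P2_def dest: sets_eq_imp_space_eq)

lemma measurable_P2: "\<mu> \<in> P2 \<Longrightarrow> measurable \<mu> N = measurable borel N"
  by (rule measurable_cong_sets) (auto simp: P2_def)

lemma measurable_couplings: "\<gamma> \<in> couplings \<mu> \<nu> \<Longrightarrow> measurable \<gamma> N = measurable borel N"
  by (rule measurable_cong_sets) (auto simp: couplings_def)

lemma borel_measurable_fst_snd [measurable]:
  "(fst :: 'a::second_countable_topology \<times> 'b::second_countable_topology \<Rightarrow> 'a) \<in> borel_measurable borel"
  "(snd :: 'a \<times> 'b \<Rightarrow> 'b) \<in> borel_measurable borel"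
  by (auto intro!: borel_measurable_continuous_onI continuous_intros)

lemma projection_in_P2:
  assumes "\<mu> \<in> P2"
  shows "projection \<theta> \<mu> \<in> P2"
proof -
  interpret prob_space \<mu> using assms by (simp add: P2_def)
  note [simp] = measurable_P2[OF assms]
  have "prob_space (projection \<theta> \<mu>)"
    unfolding projection_def by (rule prob_space_distr) simp
  moreover have "(\<integral>\<^sup>+ x. ennreal ((norm x)\<^sup>2) \<partial>projection \<theta> \<mu>)
      \<le> (\<integral>\<^sup>+ x. ennreal ((norm \<theta>)\<^sup>2) * ennreal ((norm x)\<^sup>2) \<partial>\<mu>)"
    unfolding projection_def
  proof (subst nn_integral_distr, simp, simp, rule nn_integral_mono)
    fix x
    have "\<bar>x \<bullet> \<theta>\<bar>\<^sup>2 \<le> (norm x * norm \<theta>)\<^sup>2"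
      by (intro power_mono Cauchy_Schwarz_ineq2) auto
    then show "ennreal ((norm (x \<bullet> \<theta>))\<^sup>2) \<le> ennreal ((norm \<theta>)\<^sup>2) * ennreal ((norm x)\<^sup>2)"
      by (simp add: ennreal_mult[symmetric] power_mult_distrib mult.commute)
  qed
  moreover have "\<dots> < \<infinity>"
    using assms by (subst nn_integral_cmult) (auto simp: P2_def ennreal_mult_less_top)
  ultimately show ?thesis
    by (auto simp: P2_def projection_def)
qed

lemma wasserstein_power2:
  assumes "\<mu> \<in> P2" "\<nu> \<in> P2"
  shows "ennreal ((wasserstein \<mu> \<nu>)\<^sup>2) = transport_cost \<mu> \<nu>"
  using transport_cost_finite[OF assms] by (simp add: wasserstein_def)

lemma wasserstein_nonneg: "0 \<le> wasserstein \<mu> \<nu>"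
  by (simp add: wasserstein_def)

lemma sliced_wasserstein_nonneg: "0 \<le> sliced_wasserstein \<mu> \<nu>"
  by (simp add: sliced_wasserstein_def)

text \<open>Integrate the pointwise inequality against a coupling and pass to the infimum: the easy
  half of Kantorovich duality. It provides all lower bounds for the distance of projections. The
  inequality is required only for almost every \<open>a\<close>, so that the finite support of
  \<open>\<mu>\<close> can be exploited.\<close>

lemma wasserstein_weak_duality:
  fixes f g :: "'a::euclidean_space \<Rightarrow> ennreal"
  assumes P2: "\<mu> \<in> P2" "\<nu> \<in> P2"
    and [measurable]: "f \<in> borel_measurable borel" "g \<in> borel_measurable borel"
    and le: "AE a in \<mu>. \<forall>b. f b \<le> g a + ennreal ((dist a b)\<^sup>2)"
  shows "(\<integral>\<^sup>+ y. f y \<partial>\<nu>) \<le> (\<integral>\<^sup>+ x. g x \<partial>\<mu>) + ennreal ((wasserstein \<mu> \<nu>)\<^sup>2)"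
proof -
  have "(\<integral>\<^sup>+ y. f y \<partial>\<nu>) \<le> (\<integral>\<^sup>+ x. g x \<partial>\<mu>) + (\<integral>\<^sup>+ z. ennreal ((dist (fst z) (snd z))\<^sup>2) \<partial>\<gamma>)"
    if \<gamma>: "\<gamma> \<in> couplings \<mu> \<nu>" for \<gamma>
  proof -
    note [simp] = measurable_couplings[OF \<gamma>]
    have marg: "distr \<gamma> borel fst = \<mu>" "distr \<gamma> borel snd = \<nu>"
      using \<gamma> by (auto simp: couplings_def)
    have "(\<integral>\<^sup>+ y. f y \<partial>\<nu>) = (\<integral>\<^sup>+ z. f (snd z) \<partial>\<gamma>)"
      by (subst marg(2)[symmetric], subst nn_integral_distr) auto
    also have "\<dots> \<le> (\<integral>\<^sup>+ z. g (fst z) + ennreal ((dist (fst z) (snd z))\<^sup>2) \<partial>\<gamma>)"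
    proof (rule nn_integral_mono_AE)
      have "AE a in distr \<gamma> borel fst. \<forall>b. f b \<le> g a + ennreal ((dist a b)\<^sup>2)"
        unfolding marg(1) by (rule le)
      then have "AE z in \<gamma>. \<forall>b. f b \<le> g (fst z) + ennreal ((dist (fst z) b)\<^sup>2)"
        by (rule AE_distrD[rotated]) simp
      then show "AE z in \<gamma>. f (snd z) \<le> g (fst z) + ennreal ((dist (fst z) (snd z))\<^sup>2)"
        by eventually_elim blast
    qed
    also have "\<dots> = (\<integral>\<^sup>+ z. g (fst z) \<partial>\<gamma>) + (\<integral>\<^sup>+ z. ennreal ((dist (fst z) (snd z))\<^sup>2) \<partial>\<gamma>)"
      by (rule nn_integral_add) auto
    also have "(\<integral>\<^sup>+ z. g (fst z) \<partial>\<gamma>) = (\<integral>\<^sup>+ x. g x \<partial>\<mu>)"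
      by (subst marg(1)[symmetric], subst nn_integral_distr) auto
    finally show ?thesis .
  qed
  note le_coupling = this
  show ?thesis
  proof (cases "(\<integral>\<^sup>+ x. g x \<partial>\<mu>) = \<infinity>")
    case False
    \<comment> \<open>Subtracting the finite integral of \<open>g\<close> leaves a lower bound for
      the cost of every coupling, hence for the infimum.\<close>
    then have "(\<integral>\<^sup>+ y. f y \<partial>\<nu>) - (\<integral>\<^sup>+ x. g x \<partial>\<mu>) \<le> transport_cost \<mu> \<nu>"
      unfolding transport_cost_def using le_coupling
      by (intro INF_greatest) (simp add: ennreal_minus_le_iff)
    with False show ?thesis
      unfolding wasserstein_power2[OF P2, symmetric] by (auto simp: ennreal_minus_le_iff)
  qed simp
qed

section \<open>Comparison of the sliced distance with the full distance\<close>

lemma couplings_projection: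
  assumes \<gamma>: "\<gamma> \<in> couplings \<mu> \<nu>"
  shows "distr \<gamma> borel (\<lambda>z. (fst z \<bullet> \<theta>, snd z \<bullet> \<theta>))
    \<in> couplings (projection \<theta> \<mu>) (projection \<theta> \<nu>)"
proof -
  note [simp] = measurable_couplings[OF \<gamma>]
  interpret prob_space \<gamma> using \<gamma> by (simp add: couplings_def)
  have marg: "distr \<gamma> borel fst = \<mu>" "distr \<gamma> borel snd = \<nu>"
    using \<gamma> by (auto simp: couplings_def)
  have m: "(\<lambda>z. (fst z \<bullet> \<theta>, snd z \<bullet> \<theta>)) \<in> borel_measurable borel"
    by (intro borel_measurable_Pair) auto
  show ?thesis
    unfolding couplings_def projection_def marg(1)[symmetric] marg(2)[symmetric]
    using m by (auto intro!: prob_space_distr simp: distr_distr comp_def)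
qed

text \<open>A coupling of \<open>\<mu>\<close> and \<open>\<nu>\<close> projects to a coupling in
  every direction. By Fubini and the second moment formula, the projected costs average to
  \<open>1 / DIM('a)\<close> times the original cost.\<close>

lemma sliced_wasserstein_integral_le:
  fixes \<mu> \<nu> :: "'a::euclidean_space measure"
  assumes P2: "\<mu> \<in> P2" "\<nu> \<in> P2"
  shows "(\<integral>\<^sup>+ \<theta>. ennreal ((wasserstein (projection \<theta> \<mu>) (projection \<theta> \<nu>))\<^sup>2) \<partial>uniform_sphere)
    \<le> ennreal ((wasserstein \<mu> \<nu>)\<^sup>2 / DIM('a))" (is "?I \<le> _")
proof -
  interpret S: prob_space "uniform_sphere :: 'a measure" by (rule prob_space_uniform_sphere)
  \<comment> \<open>The dimension is kept on the left so that the infimum over couplings is taken of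
    the unscaled cost.\<close>
  have "ennreal DIM('a) * ?I \<le> (\<integral>\<^sup>+ z. ennreal ((dist (fst z) (snd z))\<^sup>2) \<partial>\<gamma>)"
    if \<gamma>: "\<gamma> \<in> couplings \<mu> \<nu>" for \<gamma>
  proof -
    note [simp] = measurable_couplings[OF \<gamma>]
    interpret G: prob_space \<gamma> using \<gamma> by (simp add: couplings_def)
    interpret pair_sigma_finite "uniform_sphere :: 'a measure" \<gamma> ..
    have sets: "sets (uniform_sphere \<Otimes>\<^sub>M \<gamma>) = sets (borel :: ('a \<times> 'a \<times> 'a) measure)"
      using sets_pair_measure_cong[OF sets_uniform_sphere, of \<gamma> borel] \<gamma>
      by (metis (mono_tags, lifting) borel_prod couplings_def mem_Collect_eq)
    have m: "(\<lambda>(\<theta>, z). ennreal (((fst z - snd z) \<bullet> \<theta>)\<^sup>2)) \<in> borel_measurable (uniform_sphere \<Otimes>\<^sub>M \<gamma>)"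
      unfolding measurable_cong_sets[OF sets refl] split_beta'
      by (intro measurable_compose[OF _ measurable_ennreal] borel_measurable_continuous_onI)
        (auto intro!: continuous_intros)
    \<comment> \<open>The new integrand is jointly measurable in the direction and the pair of
      points, as Fubini requires.\<close>
    have "?I \<le> (\<integral>\<^sup>+ \<theta>. (\<integral>\<^sup>+ z. ennreal (((fst z - snd z) \<bullet> \<theta>)\<^sup>2) \<partial>\<gamma>) \<partial>uniform_sphere)"
    proof (rule nn_integral_mono)
      fix \<theta> :: 'a
      let ?\<gamma> = "distr \<gamma> borel (\<lambda>z. (fst z \<bullet> \<theta>, snd z \<bullet> \<theta>))"
      have m: "(\<lambda>z. (fst z \<bullet> \<theta>, snd z \<bullet> \<theta>)) \<in> borel_measurable borel"
        by (intro borel_measurable_Pair) auto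
      have "ennreal ((wasserstein (projection \<theta> \<mu>) (projection \<theta> \<nu>))\<^sup>2)
          = transport_cost (projection \<theta> \<mu>) (projection \<theta> \<nu>)"
        by (intro wasserstein_power2 projection_in_P2 P2)
      also have "\<dots> \<le> (\<integral>\<^sup>+ z. ennreal ((dist (fst z) (snd z))\<^sup>2) \<partial>?\<gamma>)"
        unfolding transport_cost_def by (rule INF_lower) (rule couplings_projection[OF \<gamma>])
      also have "\<dots> = (\<integral>\<^sup>+ z. ennreal (((fst z - snd z) \<bullet> \<theta>)\<^sup>2) \<partial>\<gamma>)"
        using m by (subst nn_integral_distr) (auto simp: dist_real_def inner_diff_left)
      finally show "ennreal ((wasserstein (projection \<theta> \<mu>) (projection \<theta> \<nu>))\<^sup>2) \<le> \<dots>" .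
    qed
    also have "\<dots> = (\<integral>\<^sup>+ z. (\<integral>\<^sup>+ \<theta>. ennreal (((fst z - snd z) \<bullet> \<theta>)\<^sup>2) \<partial>uniform_sphere) \<partial>\<gamma>)"
      by (rule Fubini'[OF m, symmetric])
    also have "\<dots> = (\<integral>\<^sup>+ z. ennreal (1 / DIM('a)) * ennreal ((dist (fst z) (snd z))\<^sup>2) \<partial>\<gamma>)"
      by (simp add: uniform_sphere_second_moment dist_norm ennreal_mult[symmetric])
    also have "\<dots> = ennreal (1 / DIM('a)) * (\<integral>\<^sup>+ z. ennreal ((dist (fst z) (snd z))\<^sup>2) \<partial>\<gamma>)"
      by (rule nn_integral_cmult) simp
    finally have "ennreal DIM('a) * ?I
        \<le> ennreal DIM('a) * (ennreal (1 / DIM('a)) * (\<integral>\<^sup>+ z. ennreal ((dist (fst z) (snd z))\<^sup>2) \<partial>\<gamma>))"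
      by (rule mult_left_mono) simp
    then show ?thesis
      by (simp add: mult.assoc[symmetric] ennreal_mult[symmetric] del: ennreal_of_nat_eq_real_of_nat)
  qed
  then have "ennreal DIM('a) * ?I \<le> ennreal ((wasserstein \<mu> \<nu>)\<^sup>2)"
    unfolding wasserstein_power2[OF P2] transport_cost_def by (rule INF_greatest)
  then have "ennreal (1 / DIM('a)) * (ennreal DIM('a) * ?I)
      \<le> ennreal (1 / DIM('a)) * ennreal ((wasserstein \<mu> \<nu>)\<^sup>2)"
    by (rule mult_left_mono) simp
  then show ?thesis
    by (simp add: mult.assoc[symmetric] ennreal_mult[symmetric])
qed

text \<open>The comparison with \<open>W\<close> shows that the integral is finite, so
  \<open>enn2real\<close> in the definition loses nothing.\<close>

lemma sliced_wasserstein_power2: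
  assumes "\<mu> \<in> P2" "\<nu> \<in> P2"
  shows "ennreal ((sliced_wasserstein \<mu> \<nu>)\<^sup>2)
    = (\<integral>\<^sup>+ \<theta>. ennreal ((wasserstein (projection \<theta> \<mu>) (projection \<theta> \<nu>))\<^sup>2) \<partial>uniform_sphere)"
  using le_less_trans[OF sliced_wasserstein_integral_le[OF assms] ennreal_less_top]
  by (simp add: sliced_wasserstein_def)

lemma sliced_wasserstein_le:
  fixes \<mu> \<nu> :: "'a::euclidean_space measure"
  assumes "\<mu> \<in> P2" "\<nu> \<in> P2"
  shows "sliced_wasserstein \<mu> \<nu> \<le> wasserstein \<mu> \<nu> / sqrt DIM('a)"
proof -
  have "(sliced_wasserstein \<mu> \<nu>)\<^sup>2 \<le> (wasserstein \<mu> \<nu> / sqrt DIM('a))\<^sup>2"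
    using sliced_wasserstein_integral_le[OF assms]
    by (simp add: sliced_wasserstein_power2[OF assms, symmetric] power_divide)
  then show ?thesis
    by (rule power2_le_imp_le) (simp add: wasserstein_nonneg)
qed

subsection \<open>Measures near a finitely supported measure\<close>

text \<open>\<open>X\<close> carries \<open>\<mu>\<close> but may contain points of mass zero, since
  weights may vanish. A set instead of an indexed family also merges coinciding atoms.\<close>

locale finite_support =
  fixes \<mu> :: "'a::euclidean_space measure" and X :: "'a set"
  assumes P2: "\<mu> \<in> P2"
    and finite: "finite X" and nonempty: "X \<noteq> {}"
    and support: "AE x in \<mu>. x \<in> X"
begin

text \<open>With the factor 2, a point of \<open>ball z r\<close> projects, for a unit vector
  \<open>\<theta>\<close>, at distance less than \<open>r\<close> from the projection of
  \<open>z\<close> and more than \<open>r\<close> from those of all other points of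
  \<open>X\<close>.\<close>

definition separated :: "real \<Rightarrow> 'a \<Rightarrow> bool" where
  "separated r \<theta> \<longleftrightarrow> (\<forall>z\<in>X. \<forall>w\<in>X. z \<noteq> w \<longrightarrow> 2 * r \<le> \<bar>(z - w) \<bullet> \<theta>\<bar>)"

lemma closed_separated: "closed {\<theta>. separated r \<theta>}"
proof -
  have "{\<theta>. separated r \<theta>} = (\<Inter>z\<in>X. \<Inter>w\<in>X-{z}. {\<theta>. 2 * r \<le> \<bar>(z - w) \<bullet> \<theta>\<bar>})"
    by (auto simp: separated_def)
  also have "closed \<dots>"
    by (intro closed_INT ballI closed_Collect_le continuous_intros)
  finally show ?thesis .
qed

lemma measurable_separated [measurable]: "Measurable.pred borel (separated r)"
  using borel_closed[OF closed_separated[of r]] by (simp add: pred_def)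

lemma AE_projection: "AE a in projection \<theta> \<mu>. a \<in> (\<lambda>z. z \<bullet> \<theta>) ` X"
proof -
  have "{a. a \<in> (\<lambda>z. z \<bullet> \<theta>) ` X} \<in> sets borel"
    using finite by (simp add: borel_closed finite_imp_closed)
  then show ?thesis
    unfolding projection_def
    by (subst AE_distr_iff) (use support in \<open>auto simp: measurable_P2[OF P2]\<close>)
qed

text \<open>Weak duality with \<open>g = 0\<close>: the projection of \<open>\<mu>\<close> lives on
  the projected atoms, so \<open>f\<close> only has to lie below the squared distance to each of
  them.\<close>

lemma nn_integral_projection_le:
  assumes \<nu>: "\<nu> \<in> P2" and f: "f \<in> borel_measurable borel"
    and le: "\<And>z b. z \<in> X \<Longrightarrow> f b \<le> ennreal ((b - z \<bullet> \<theta>)\<^sup>2)"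
  shows "(\<integral>\<^sup>+ y. f (y \<bullet> \<theta>) \<partial>\<nu>)
    \<le> ennreal ((wasserstein (projection \<theta> \<mu>) (projection \<theta> \<nu>))\<^sup>2)"
proof -
  have "(\<integral>\<^sup>+ y. f (y \<bullet> \<theta>) \<partial>\<nu>) = (\<integral>\<^sup>+ b. f b \<partial>projection \<theta> \<nu>)"
    unfolding projection_def using f by (subst nn_integral_distr) (auto simp: measurable_P2[OF \<nu>])
  also have "\<dots> \<le> (\<integral>\<^sup>+ a. 0 \<partial>projection \<theta> \<mu>)
      + ennreal ((wasserstein (projection \<theta> \<mu>) (projection \<theta> \<nu>))\<^sup>2)"
  proof (rule wasserstein_weak_duality)
    show "AE a in projection \<theta> \<mu>. \<forall>b. f b \<le> 0 + ennreal ((dist a b)\<^sup>2)"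
      using AE_projection[of \<theta>]
      by eventually_elim (use le in \<open>auto simp: dist_real_def power2_commute\<close>)
  qed (use f \<nu> P2 in \<open>auto intro: projection_in_P2\<close>)
  finally show ?thesis by simp
qed

lemma sets_sphere_pair:
  assumes "\<nu> \<in> P2"
  shows "sets (uniform_sphere \<Otimes>\<^sub>M \<nu>) = sets (borel \<Otimes>\<^sub>M (borel :: 'a measure))"
  using assms by (intro sets_pair_measure_cong) (auto simp: P2_def)

section \<open>Mass and local cost of measures at small sliced distance\<close>

text \<open>Fix \<open>y\<close> outside the balls. By a union bound over \<open>X\<close>, at least
  half of the directions keep \<open>y \<bullet> \<theta>\<close> at distance
  \<open>\<delta> * r\<close> or more from every projected atom, so mass at \<open>y\<close> costs
  at least \<open>(\<delta> * r)^2\<close> there. The good directions depend on \<open>y\<close>,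
  hence the use of Fubini.\<close>

lemma measure_outside_le:
  assumes \<nu>: "\<nu> \<in> P2" and "r > 0" "\<delta> > 0"
    and slab: "\<And>u::'a. measure uniform_sphere {\<theta>. \<bar>u \<bullet> \<theta>\<bar> < \<delta> * norm u} \<le> 1 / (2 * card X)"
  shows "(\<delta> * r)\<^sup>2 / 2 * measure \<nu> {y. \<forall>z\<in>X. r \<le> dist z y} \<le> (sliced_wasserstein \<mu> \<nu>)\<^sup>2"
proof -
  interpret S: prob_space "uniform_sphere :: 'a measure" by (rule prob_space_uniform_sphere)
  interpret N: prob_space \<nu> using \<nu> by (simp add: P2_def)
  interpret pair_sigma_finite "uniform_sphere :: 'a measure" \<nu> ..
  note [measurable] = finite
  define A where "A = {y. \<forall>z\<in>X. r \<le> dist z y}"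
  have A [measurable]: "A \<in> sets borel"
    unfolding A_def by measurable
  define c where "c = ennreal ((\<delta> * r)\<^sup>2)"
  \<comment> \<open>Failure of \<open>Q\<close> puts \<open>\<theta>\<close> into one of
    \<open>card X\<close> slabs, which explains the bound \<open>1 / (2 * card X)\<close> in
    \<open>slab\<close>.\<close>
  define Q where "Q y \<theta> \<longleftrightarrow> (\<forall>z\<in>X. \<delta> * norm (y - z) \<le> \<bar>(y - z) \<bullet> \<theta>\<bar>)" for y \<theta> :: 'a
  define H where "H y \<theta> = (if y \<in> A \<and> Q y \<theta> then c else 0)" for y \<theta> :: 'a
  have H: "(\<lambda>(\<theta>, y). H y \<theta>) \<in> borel_measurable (uniform_sphere \<Otimes>\<^sub>M \<nu>)"
    unfolding measurable_cong_sets[OF sets_sphere_pair[OF \<nu>] refl] H_def Q_def split_beta' by measurable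
  have half: "ennreal (1 / 2) \<le> emeasure uniform_sphere {\<theta>. Q y \<theta>}" for y
  proof -
    have Q [measurable]: "Measurable.pred borel (Q y)"
      unfolding Q_def by measurable
    have "measure uniform_sphere (UNIV - {\<theta>. Q y \<theta>})
        = measure uniform_sphere (\<Union>z\<in>X. {\<theta>. \<bar>(y - z) \<bullet> \<theta>\<bar> < \<delta> * norm (y - z)})"
      by (rule arg_cong[where f = "measure uniform_sphere"]) (auto simp: Q_def not_le)
    also have "\<dots> \<le> (\<Sum>z\<in>X. measure uniform_sphere {\<theta>. \<bar>(y - z) \<bullet> \<theta>\<bar> < \<delta> * norm (y - z)})"
      by (rule S.finite_measure_subadditive_finite) (use finite in auto)
    also have "\<dots> \<le> (\<Sum>z\<in>X. 1 / (2 * card X))"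
      by (intro sum_mono slab)
    also have "\<dots> = 1 / 2" using finite nonempty by simp
    finally have "1 / 2 \<le> measure uniform_sphere {\<theta>. Q y \<theta>}"
      using S.prob_compl[of "{\<theta>. Q y \<theta>}"] by (simp add: uniform_sphere_def)
    then show ?thesis unfolding S.emeasure_eq_measure by (rule ennreal_leI)
  qed
  have "c * ennreal (1 / 2) * emeasure \<nu> A = (\<integral>\<^sup>+ y. c * ennreal (1 / 2) * indicator A y \<partial>\<nu>)"
    using \<nu> by (subst nn_integral_cmult_indicator) (auto simp: P2_def)
  also have "\<dots> \<le> (\<integral>\<^sup>+ y. (\<integral>\<^sup>+ \<theta>. H y \<theta> \<partial>uniform_sphere) \<partial>\<nu>)"
  proof (rule nn_integral_mono)
    fix y
    have Q: "{\<theta>. Q y \<theta>} \<in> sets borel"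
      unfolding Q_def by measurable
    have "c * ennreal (1 / 2) * indicator A y
        \<le> c * emeasure uniform_sphere {\<theta>. Q y \<theta>} * indicator A y"
      by (intro mult_right_mono mult_left_mono half) auto
    also have "\<dots> = (\<integral>\<^sup>+ \<theta>. c * indicator A y * indicator {\<theta>. Q y \<theta>} \<theta> \<partial>uniform_sphere)"
      using Q by (subst nn_integral_cmult_indicator) (auto simp: ac_simps)
    also have "\<dots> = (\<integral>\<^sup>+ \<theta>. H y \<theta> \<partial>uniform_sphere)"
      by (intro nn_integral_cong) (auto simp: H_def indicator_def)
    finally show "c * ennreal (1 / 2) * indicator A y \<le> \<dots>" .
  qed
  also have "\<dots> = (\<integral>\<^sup>+ \<theta>. (\<integral>\<^sup>+ y. H y \<theta> \<partial>\<nu>) \<partial>uniform_sphere)"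
    by (rule Fubini'[OF H])
  also have "\<dots> \<le> (\<integral>\<^sup>+ \<theta>. ennreal ((wasserstein (projection \<theta> \<mu>) (projection \<theta> \<nu>))\<^sup>2) \<partial>uniform_sphere)"
  proof (rule nn_integral_mono)
    fix \<theta> :: 'a
    \<comment> \<open>\<open>H\<close> depends on all of \<open>y\<close>, while duality for
      projections takes a function of \<open>y \<bullet> \<theta>\<close>; this is such a
      majorant.\<close>
    let ?f = "\<lambda>b. if \<forall>z\<in>X. \<delta> * r \<le> \<bar>b - z \<bullet> \<theta>\<bar> then c else 0"
    have "(\<integral>\<^sup>+ y. H y \<theta> \<partial>\<nu>) \<le> (\<integral>\<^sup>+ y. ?f (y \<bullet> \<theta>) \<partial>\<nu>)"
    proof (rule nn_integral_mono)
      fix y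
      show "H y \<theta> \<le> ?f (y \<bullet> \<theta>)"
      proof (cases "y \<in> A \<and> Q y \<theta>")
        case True
        have "\<delta> * r \<le> \<bar>y \<bullet> \<theta> - z \<bullet> \<theta>\<bar>" if z: "z \<in> X" for z
        proof -
          have "\<delta> * r \<le> \<delta> * norm (y - z)"
            using True z \<open>\<delta> > 0\<close> by (auto simp: A_def dist_norm norm_minus_commute)
          also have "\<dots> \<le> \<bar>(y - z) \<bullet> \<theta>\<bar>" using True z by (auto simp: Q_def)
          finally show ?thesis by (simp add: inner_diff_left)
        qed
        then show ?thesis by (simp add: H_def)
      qed (auto simp: H_def)
    qed
    also have "\<dots> \<le> ennreal ((wasserstein (projection \<theta> \<mu>) (projection \<theta> \<nu>))\<^sup>2)"
    proof (rule nn_integral_projection_le[OF \<nu>])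
      show "?f \<in> borel_measurable borel" by measurable
      show "?f b \<le> ennreal ((b - z \<bullet> \<theta>)\<^sup>2)" if z: "z \<in> X" for z b
      proof (cases "\<forall>z\<in>X. \<delta> * r \<le> \<bar>b - z \<bullet> \<theta>\<bar>")
        case True
        with z have "\<delta> * r \<le> \<bar>b - z \<bullet> \<theta>\<bar>" by blast
        then have "(\<delta> * r)\<^sup>2 \<le> \<bar>b - z \<bullet> \<theta>\<bar>\<^sup>2"
          using \<open>\<delta> > 0\<close> \<open>r > 0\<close> by (intro power_mono) auto
        with True show ?thesis by (simp add: c_def)
      qed auto
    qed
    finally show "(\<integral>\<^sup>+ y. H y \<theta> \<partial>\<nu>) \<le> \<dots>" .
  qed
  also have "\<dots> = ennreal ((sliced_wasserstein \<mu> \<nu>)\<^sup>2)"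
    by (rule sliced_wasserstein_power2[OF P2 \<nu>, symmetric])
  finally have "ennreal ((\<delta> * r)\<^sup>2 * (1 / 2) * measure \<nu> A) \<le> ennreal ((sliced_wasserstein \<mu> \<nu>)\<^sup>2)"
    by (simp add: c_def N.emeasure_eq_measure ennreal_mult[symmetric] del: ennreal_half)
  then show ?thesis by (simp add: A_def)
qed

text \<open>Only the mass \<open>1 - measure \<mu> {z}\<close> of \<open>\<mu>\<close> lies away
  from \<open>z\<close>, so an excess of \<open>\<nu>\<close> in the other balls has to be brought
  from \<open>z\<close>. In a separated direction this costs at least \<open>r^2\<close> per unit of
  mass, and such directions make up at least one half.\<close>

lemma measure_other_balls_le:
  assumes \<nu>: "\<nu> \<in> P2" and "r > 0" and z: "z \<in> X"
    and half: "1 / 2 \<le> measure uniform_sphere {\<theta>. separated r \<theta>}"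
  shows "r\<^sup>2 * (measure \<nu> (\<Union>w\<in>X-{z}. ball w r) - (1 - measure \<mu> {z}))
    \<le> 2 * (sliced_wasserstein \<mu> \<nu>)\<^sup>2"
proof -
  interpret S: prob_space "uniform_sphere :: 'a measure" by (rule prob_space_uniform_sphere)
  interpret N: prob_space \<nu> using \<nu> by (simp add: P2_def)
  interpret M: prob_space \<mu> using P2 by (simp add: P2_def)
  define U where "U = (\<Union>w\<in>X-{z}. ball w r)"
  define A where "A = r\<^sup>2 * (measure \<nu> U - (1 - measure \<mu> {z}))"
  have U [measurable]: "U \<in> sets borel" by (auto simp: U_def intro!: borel_open)
  have A: "ennreal A \<le> ennreal ((wasserstein (projection \<theta> \<mu>) (projection \<theta> \<nu>))\<^sup>2)"
    if sep: "separated r \<theta>" and \<theta>: "norm \<theta> = 1" for \<theta>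
  proof -
    let ?W = "(wasserstein (projection \<theta> \<mu>) (projection \<theta> \<nu>))\<^sup>2"
    \<comment> \<open>A dual pair: mass ending at distance \<open>r\<close> or more from
      \<open>z \<bullet> \<theta>\<close> either started away from
      \<open>z \<bullet> \<theta>\<close> or paid at least \<open>r^2\<close>.\<close>
    let ?f = "\<lambda>b. ennreal (r\<^sup>2) * indicator {b. r \<le> \<bar>b - z \<bullet> \<theta>\<bar>} b"
    let ?g = "\<lambda>a. ennreal (r\<^sup>2) * indicator (- {z \<bullet> \<theta>}) a"
    have "ennreal (r\<^sup>2) * emeasure \<nu> U = (\<integral>\<^sup>+ y. ennreal (r\<^sup>2) * indicator U y \<partial>\<nu>)"
      using \<nu> by (subst nn_integral_cmult_indicator) (auto simp: P2_def)
    also have "\<dots> \<le> (\<integral>\<^sup>+ y. ?f (y \<bullet> \<theta>) \<partial>\<nu>)"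
    proof (intro nn_integral_mono mult_left_mono)
      fix y
      have "r \<le> \<bar>y \<bullet> \<theta> - z \<bullet> \<theta>\<bar>" if w: "w \<in> X" "w \<noteq> z" "dist w y < r" for w
      proof -
        have "2 * r \<le> \<bar>(w - z) \<bullet> \<theta>\<bar>" using sep w z by (auto simp: separated_def)
        moreover have "\<bar>(w - y) \<bullet> \<theta>\<bar> \<le> dist w y"
          using Cauchy_Schwarz_ineq2[of "w - y" \<theta>] \<theta> by (simp add: dist_norm)
        ultimately show ?thesis using w by (simp add: inner_diff_left)
      qed
      then show "indicator U y \<le> (indicator {b. r \<le> \<bar>b - z \<bullet> \<theta>\<bar>} (y \<bullet> \<theta>) :: ennreal)"
        by (auto simp: U_def indicator_def)
    qed simp
    also have "\<dots> = (\<integral>\<^sup>+ b. ?f b \<partial>projection \<theta> \<nu>)"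
      unfolding projection_def by (subst nn_integral_distr) (auto simp: measurable_P2[OF \<nu>])
    also have "\<dots> \<le> (\<integral>\<^sup>+ a. ?g a \<partial>projection \<theta> \<mu>) + ennreal ?W"
    proof (rule wasserstein_weak_duality)
      have "r\<^sup>2 \<le> (z \<bullet> \<theta> - b)\<^sup>2" if "r \<le> \<bar>b - z \<bullet> \<theta>\<bar>" for b
        using power_mono[OF that, of 2] \<open>r > 0\<close> by (simp add: power2_commute)
      then show "AE a in projection \<theta> \<mu>. \<forall>b. ?f b \<le> ?g a + ennreal ((dist a b)\<^sup>2)"
        by (intro AE_I2 allI) (auto simp: indicator_def dist_real_def)
    qed (use \<nu> P2 in \<open>auto intro: projection_in_P2\<close>)
    also have "(\<integral>\<^sup>+ a. ?g a \<partial>projection \<theta> \<mu>) = (\<integral>\<^sup>+ y. ?g (y \<bullet> \<theta>) \<partial>\<mu>)"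
      unfolding projection_def by (subst nn_integral_distr) (auto simp: measurable_P2[OF P2])
    also have "\<dots> \<le> (\<integral>\<^sup>+ y. ennreal (r\<^sup>2) * indicator (- {z}) y \<partial>\<mu>)"
      by (intro nn_integral_mono mult_left_mono) (auto simp: indicator_def)
    also have "\<dots> = ennreal (r\<^sup>2) * emeasure \<mu> (- {z})"
      using P2 by (subst nn_integral_cmult_indicator) (auto simp: P2_def)
    also have "emeasure \<mu> (- {z}) = ennreal (1 - measure \<mu> {z})"
      using M.prob_compl[of "{z}"] P2
      by (simp add: M.emeasure_eq_measure space_P2[OF P2] Compl_eq_Diff_UNIV P2_def)
    finally have "ennreal (r\<^sup>2 * measure \<nu> U) \<le> ennreal (r\<^sup>2 * (1 - measure \<mu> {z}) + ?W)"
      by (simp add: N.emeasure_eq_measure ennreal_mult[symmetric] ennreal_plus[symmetric]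
          del: ennreal_plus)
    moreover have "0 \<le> r\<^sup>2 * (1 - measure \<mu> {z}) + ?W"
      using M.prob_le_1 by simp
    ultimately have "A \<le> ?W"
      by (subst (asm) ennreal_le_iff) (auto simp: A_def algebra_simps)
    then show ?thesis by (rule ennreal_leI)
  qed
  have "ennreal A * ennreal (1 / 2) \<le> ennreal A * emeasure uniform_sphere {\<theta>. separated r \<theta>}"
    unfolding S.emeasure_eq_measure using half by (intro mult_left_mono ennreal_leI) auto
  also have "\<dots> = (\<integral>\<^sup>+ \<theta>. ennreal A * indicator {\<theta>. separated r \<theta>} \<theta> \<partial>uniform_sphere)"
    by (subst nn_integral_cmult_indicator) auto
  also have "\<dots> \<le> (\<integral>\<^sup>+ \<theta>. ennreal ((wasserstein (projection \<theta> \<mu>) (projection \<theta> \<nu>))\<^sup>2) \<partial>uniform_sphere)"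
  proof (rule nn_integral_mono_AE)
    show "AE \<theta> in uniform_sphere. ennreal A * indicator {\<theta>. separated r \<theta>} \<theta>
        \<le> ennreal ((wasserstein (projection \<theta> \<mu>) (projection \<theta> \<nu>))\<^sup>2)"
      using AE_uniform_sphere
    proof eventually_elim
      case (elim \<theta>)
      then show ?case using A[of \<theta>] by (auto simp: indicator_def)
    qed
  qed
  also have "\<dots> = ennreal ((sliced_wasserstein \<mu> \<nu>)\<^sup>2)"
    by (rule sliced_wasserstein_power2[OF P2 \<nu>, symmetric])
  \<comment> \<open>\<open>ennreal\<close> truncates a negative \<open>A\<close> to 0, but then the
    claim is trivial.\<close>
  finally have "A * (1 / 2) \<le> (sliced_wasserstein \<mu> \<nu>)\<^sup>2 \<or> A < 0"
    by (cases "A < 0") (simp_all add: ennreal_mult[symmetric] del: ennreal_half)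
  then show ?thesis
    unfolding A_def U_def[symmetric] using zero_le_power2[of "sliced_wasserstein \<mu> \<nu>"] by argo
qed

text \<open>For small \<open>r\<close> this is the part of \<open>W\<^sup>2(\<mu>, \<nu>)\<close> due to the mass of \<open>\<nu>\<close> near the support of \<open>\<mu>\<close>.\<close>

definition local_cost :: "real \<Rightarrow> 'a measure \<Rightarrow> ennreal" where
  "local_cost r \<nu> = (\<integral>\<^sup>+ y. (\<Sum>z\<in>X. ennreal ((norm (y - z))\<^sup>2) * indicator (ball z r) y) \<partial>\<nu>)"

lemma local_cost_finite:
  assumes \<nu>: "\<nu> \<in> P2"
  shows "local_cost r \<nu> < \<infinity>"
proof -
  interpret N: prob_space \<nu> using \<nu> by (simp add: P2_def)
  have "local_cost r \<nu> \<le> (\<integral>\<^sup>+ y. (\<Sum>z\<in>X. ennreal (r\<^sup>2)) \<partial>\<nu>)"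
    unfolding local_cost_def
  proof (intro nn_integral_mono sum_mono)
    fix y z
    show "ennreal ((norm (y - z))\<^sup>2) * indicator (ball z r) y \<le> ennreal (r\<^sup>2)"
      by (auto simp: indicator_def dist_norm norm_minus_commute intro!: ennreal_leI power_mono)
  qed
  also have "\<dots> < \<infinity>"
    using N.emeasure_space_1 by (simp add: ennreal_mult_less_top of_nat_less_top)
  finally show ?thesis .
qed

text \<open>In a separated direction, weak duality bounds the projected local cost by the squared
  distance of the projections; in the others, Cauchy-Schwarz bounds it by the full local cost.
  Averaging by the second moment formula produces the factor \<open>DIM('a)\<close>. The last term
  is absorbed later by a small \<open>\<kappa>\<close>.\<close>

lemma local_cost_le:
  fixes \<kappa> :: real
  assumes \<nu>: "\<nu> \<in> P2"
    and bad: "measure uniform_sphere {\<theta>. \<not> separated r \<theta>} \<le> \<kappa>"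
  shows "enn2real (local_cost r \<nu>)
    \<le> DIM('a) * (sliced_wasserstein \<mu> \<nu>)\<^sup>2 + DIM('a) * \<kappa> * enn2real (local_cost r \<nu>)"
proof -
  interpret S: prob_space "uniform_sphere :: 'a measure" by (rule prob_space_uniform_sphere)
  interpret N: prob_space \<nu> using \<nu> by (simp add: P2_def)
  interpret pair_sigma_finite "uniform_sphere :: 'a measure" \<nu> ..
  define D where "D = local_cost r \<nu>"
  define h where "h \<theta> y = (\<Sum>z\<in>X. ennreal (((y - z) \<bullet> \<theta>)\<^sup>2) * indicator (ball z r) y)" for \<theta> y :: 'a
  define \<Phi> where "\<Phi> \<theta> = (\<integral>\<^sup>+ y. h \<theta> y \<partial>\<nu>)" for \<theta>
  have [measurable]: "ball z r \<in> sets borel" for z :: 'a by simp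
  have h: "(\<lambda>(\<theta>, y). h \<theta> y) \<in> borel_measurable (uniform_sphere \<Otimes>\<^sub>M \<nu>)"
    unfolding measurable_cong_sets[OF sets_sphere_pair[OF \<nu>] refl] h_def split_beta' by measurable
  have "\<Phi> \<in> borel_measurable uniform_sphere"
    unfolding \<Phi>_def using h by (rule N.borel_measurable_nn_integral)
  then have \<Phi> [measurable]: "\<Phi> \<in> borel_measurable borel"
    by (simp add: measurable_cong_sets[OF sets_uniform_sphere refl])
  have "D = (\<integral>\<^sup>+ y. ennreal DIM('a) * (\<integral>\<^sup>+ \<theta>. h \<theta> y \<partial>uniform_sphere) \<partial>\<nu>)"
    unfolding D_def local_cost_def
  proof (rule nn_integral_cong)
    fix y
    have "(\<integral>\<^sup>+ \<theta>. h \<theta> y \<partial>uniform_sphere)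
        = (\<Sum>z\<in>X. (\<integral>\<^sup>+ \<theta>. ennreal (((y - z) \<bullet> \<theta>)\<^sup>2) \<partial>uniform_sphere) * indicator (ball z r) y)"
      unfolding h_def
      by (subst nn_integral_sum)
        (auto simp: nn_integral_multc measurable_cong_sets[OF sets_uniform_sphere refl])
    then show "(\<Sum>z\<in>X. ennreal ((norm (y - z))\<^sup>2) * indicator (ball z r) y)
        = ennreal DIM('a) * (\<integral>\<^sup>+ \<theta>. h \<theta> y \<partial>uniform_sphere)"
      by (simp add: uniform_sphere_second_moment sum_distrib_left mult.assoc[symmetric]
          ennreal_mult[symmetric] del: ennreal_of_nat_eq_real_of_nat)
  qed
  also have "\<dots> = ennreal DIM('a) * (\<integral>\<^sup>+ y. (\<integral>\<^sup>+ \<theta>. h \<theta> y \<partial>uniform_sphere) \<partial>\<nu>)"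
  proof (rule nn_integral_cmult)
    have "(\<lambda>(y, \<theta>). h \<theta> y) \<in> borel_measurable (\<nu> \<Otimes>\<^sub>M uniform_sphere)"
      using h by (subst measurable_pair_swap_iff) (simp add: split_beta')
    then show "(\<lambda>y. \<integral>\<^sup>+ \<theta>. h \<theta> y \<partial>uniform_sphere) \<in> borel_measurable \<nu>"
      by (rule S.borel_measurable_nn_integral)
  qed
  also have "(\<integral>\<^sup>+ y. (\<integral>\<^sup>+ \<theta>. h \<theta> y \<partial>uniform_sphere) \<partial>\<nu>) = (\<integral>\<^sup>+ \<theta>. \<Phi> \<theta> \<partial>uniform_sphere)"
    unfolding \<Phi>_def by (rule Fubini'[OF h])
  \<comment> \<open>The split is made on \<open>\<Phi>\<close> and not on the squared distances of the projections: these are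
    not shown to be measurable in \<open>\<theta>\<close>, and the integral of such functions is only superadditive.\<close>
  also have "\<dots> = (\<integral>\<^sup>+ \<theta>. \<Phi> \<theta> * indicator {\<theta>. separated r \<theta>} \<theta>
      + \<Phi> \<theta> * indicator {\<theta>. \<not> separated r \<theta>} \<theta> \<partial>uniform_sphere)"
    by (intro nn_integral_cong) (auto simp: indicator_def)
  also have "\<dots> = (\<integral>\<^sup>+ \<theta>. \<Phi> \<theta> * indicator {\<theta>. separated r \<theta>} \<theta> \<partial>uniform_sphere)
      + (\<integral>\<^sup>+ \<theta>. \<Phi> \<theta> * indicator {\<theta>. \<not> separated r \<theta>} \<theta> \<partial>uniform_sphere)"
    by (rule nn_integral_add) (auto simp: measurable_cong_sets[OF sets_uniform_sphere refl])
  also have "(\<integral>\<^sup>+ \<theta>. \<Phi> \<theta> * indicator {\<theta>. separated r \<theta>} \<theta> \<partial>uniform_sphere)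
      \<le> (\<integral>\<^sup>+ \<theta>. ennreal ((wasserstein (projection \<theta> \<mu>) (projection \<theta> \<nu>))\<^sup>2) \<partial>uniform_sphere)"
  proof (rule nn_integral_mono_AE)
    show "AE \<theta> in uniform_sphere. \<Phi> \<theta> * indicator {\<theta>. separated r \<theta>} \<theta>
        \<le> ennreal ((wasserstein (projection \<theta> \<mu>) (projection \<theta> \<nu>))\<^sup>2)"
      using AE_uniform_sphere
    proof eventually_elim
      case (elim \<theta>)
      then have \<theta>: "norm \<theta> = 1" by simp
      show ?case
      proof (cases "separated r \<theta>")
        case True
        \<comment> \<open>The squared distance to the nearest projected atom is the largest function
          that \<open>nn_integral_projection_le\<close> admits.\<close>
        let ?f = "\<lambda>b. INF z\<in>X. ennreal ((b - z \<bullet> \<theta>)\<^sup>2)"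
        have "h \<theta> y \<le> ?f (y \<bullet> \<theta>)" for y
        proof (cases "\<exists>z\<in>X. y \<in> ball z r")
          case True
          then obtain z where z: "z \<in> X" "dist z y < r" by auto
          have proj: "\<bar>(y - w) \<bullet> \<theta>\<bar> \<le> dist w y" for w
            using Cauchy_Schwarz_ineq2[of "y - w" \<theta>] \<theta> by (simp add: dist_norm norm_minus_commute)
          have far: "r \<le> \<bar>(y - w) \<bullet> \<theta>\<bar>" if "w \<in> X" "w \<noteq> z" for w
            using \<open>separated r \<theta>\<close> that z proj[of z]
            by (fastforce simp: separated_def inner_diff_left)
          \<comment> \<open>Separation of the projections forces the balls to be disjoint, so only
            the term of \<open>z\<close> survives in \<open>h\<close>.\<close>
          have "y \<notin> ball w r" if "w \<in> X" "w \<noteq> z" for w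
            using far[OF that] proj[of w] by auto
          then have "h \<theta> y = (\<Sum>w\<in>X. if w = z then ennreal (((y - z) \<bullet> \<theta>)\<^sup>2) else 0)"
            unfolding h_def using z by (intro sum.cong) (auto simp: indicator_def)
          then have "h \<theta> y = ennreal (((y - z) \<bullet> \<theta>)\<^sup>2)"
            using z finite by simp
          also have "\<dots> \<le> ?f (y \<bullet> \<theta>)"
          proof (intro INF_greatest ennreal_leI)
            fix w assume w: "w \<in> X"
            have "\<bar>(y - z) \<bullet> \<theta>\<bar> \<le> \<bar>(y - w) \<bullet> \<theta>\<bar>"
              using far[OF w] proj[of z] z by (cases "w = z") auto
            then show "((y - z) \<bullet> \<theta>)\<^sup>2 \<le> (y \<bullet> \<theta> - w \<bullet> \<theta>)\<^sup>2"
              by (simp add: abs_le_square_iff inner_diff_left)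
          qed
          finally show ?thesis .
        qed (auto simp: h_def indicator_def)
        then have "\<Phi> \<theta> \<le> (\<integral>\<^sup>+ y. ?f (y \<bullet> \<theta>) \<partial>\<nu>)"
          unfolding \<Phi>_def by (intro nn_integral_mono)
        also have "\<dots> \<le> ennreal ((wasserstein (projection \<theta> \<mu>) (projection \<theta> \<nu>))\<^sup>2)"
        proof (rule nn_integral_projection_le[OF \<nu>])
          show "?f \<in> borel_measurable borel"
            using countable_finite[OF finite] by (intro borel_measurable_INF) auto
        qed (rule INF_lower)
        finally show ?thesis using True by simp
      qed simp
    qed
  qed
  also have "\<dots> = ennreal ((sliced_wasserstein \<mu> \<nu>)\<^sup>2)"
    by (rule sliced_wasserstein_power2[OF P2 \<nu>, symmetric])
  also have "(\<integral>\<^sup>+ \<theta>. \<Phi> \<theta> * indicator {\<theta>. \<not> separated r \<theta>} \<theta> \<partial>uniform_sphere)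
      \<le> (\<integral>\<^sup>+ \<theta>. D * indicator {\<theta>. \<not> separated r \<theta>} \<theta> \<partial>uniform_sphere)"
  proof (rule nn_integral_mono_AE)
    show "AE \<theta> in uniform_sphere. \<Phi> \<theta> * indicator {\<theta>. \<not> separated r \<theta>} \<theta>
        \<le> D * indicator {\<theta>. \<not> separated r \<theta>} \<theta>"
      using AE_uniform_sphere
    proof eventually_elim
      case (elim \<theta>)
      have "((y - z) \<bullet> \<theta>)\<^sup>2 \<le> (norm (y - z))\<^sup>2" for y z
        using Cauchy_Schwarz_ineq2[of "y - z" \<theta>] elim by (simp add: abs_le_square_iff[symmetric])
      then have "\<Phi> \<theta> \<le> D"
        unfolding \<Phi>_def D_def local_cost_def h_def
        by (intro nn_integral_mono sum_mono mult_right_mono ennreal_leI) auto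
      then show ?case by (rule mult_right_mono) simp
    qed
  qed
  also have "\<dots> = D * emeasure uniform_sphere {\<theta>. \<not> separated r \<theta>}"
    by (rule nn_integral_cmult_indicator) simp
  also have "\<dots> \<le> D * ennreal \<kappa>"
    unfolding S.emeasure_eq_measure using bad by (intro mult_left_mono ennreal_leI) auto
  finally have le: "D \<le> ennreal DIM('a) * (ennreal ((sliced_wasserstein \<mu> \<nu>)\<^sup>2) + D * ennreal \<kappa>)"
    by (simp add: mult_left_mono add_mono)
  have \<kappa>: "0 \<le> \<kappa>" using bad measure_nonneg[of uniform_sphere "{\<theta>. \<not> separated r \<theta>}"] by linarith
  obtain d where d: "D = ennreal d" "0 \<le> d"
    using local_cost_finite[OF \<nu>, of r] unfolding D_def[symmetric] by (cases D) auto
  have "d \<le> DIM('a) * ((sliced_wasserstein \<mu> \<nu>)\<^sup>2 + d * \<kappa>)"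
    using le d(2) \<kappa> unfolding d(1)
    by (simp add: ennreal_mult[symmetric] ennreal_plus[symmetric] del: ennreal_plus
        ennreal_of_nat_eq_real_of_nat)
  then show ?thesis
    unfolding D_def[symmetric] d(1) using d(2) by (simp add: algebra_simps)
qed

lemma nn_integral_eq_sum:
  assumes [measurable]: "f \<in> borel_measurable borel"
  shows "(\<integral>\<^sup>+ x. f x \<partial>\<mu>) = (\<Sum>z\<in>X. f z * ennreal (measure \<mu> {z}))"
proof -
  interpret M: prob_space \<mu> using P2 by (simp add: P2_def)
  have "(\<integral>\<^sup>+ x. f x \<partial>\<mu>) = (\<integral>\<^sup>+ x. (\<Sum>z\<in>X. f z * indicator {z} x) \<partial>\<mu>)"
  proof (rule nn_integral_cong_AE)
    show "AE x in \<mu>. f x = (\<Sum>z\<in>X. f z * indicator {z} x)"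
      using support
    proof eventually_elim
      case (elim x)
      then have "(\<Sum>z\<in>X. f z * indicator {z} x) = (\<Sum>z\<in>X. if x = z then f z else 0)"
        by (intro sum.cong) (auto simp: indicator_def)
      then show ?case using elim finite by simp
    qed
  qed
  also have "\<dots> = (\<Sum>z\<in>X. f z * ennreal (measure \<mu> {z}))"
    using P2 by (subst nn_integral_sum)
      (auto simp: measurable_P2[OF P2] nn_integral_cmult_indicator M.emeasure_eq_measure P2_def)
  finally show ?thesis .
qed

text \<open>A direction that is not separated lies in a slab orthogonal to some difference
  \<open>z - w\<close>, of relative width at most \<open>\<delta>\<close> once
  \<open>2 * r \<le> \<delta> * s\<close>, where \<open>s\<close> bounds the distances of distinct
  points from below. A union bound over ordered pairs concludes.\<close>

lemma separated_eventually:
  assumes "\<kappa> > 0"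
  shows "\<exists>r0>0. \<forall>r. 0 < r \<longrightarrow> r \<le> r0 \<longrightarrow>
    measure uniform_sphere {\<theta>. \<not> separated r \<theta>} \<le> \<kappa> \<and> (\<forall>z\<in>X. \<forall>w\<in>X. z \<noteq> w \<longrightarrow> 2 * r \<le> dist z w)"
proof -
  interpret S: prob_space "uniform_sphere :: 'a measure" by (rule prob_space_uniform_sphere)
  let ?P = "SIGMA z:X. X - {z}"
  have fP: "finite ?P" using finite by auto
  \<comment> \<open>The summand 1 keeps the bound positive when \<open>X\<close> is a singleton and
    \<open>?P\<close> is empty.\<close>
  obtain \<delta> where \<delta>: "\<delta> > 0"
    and slab: "\<And>u::'a. measure uniform_sphere {\<theta>. \<bar>u \<bullet> \<theta>\<bar> < \<delta> * norm u} \<le> \<kappa> / (card ?P + 1)"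
    using uniform_sphere_small_slab_uniform[of "\<kappa> / (card ?P + 1)"] assms
    by (auto simp: add_pos_nonneg)
  obtain s where s: "s > 0" "\<And>z w. (z, w) \<in> ?P \<Longrightarrow> s \<le> dist z w"
  proof (cases "?P = {}")
    case False
    show thesis
    proof (rule that[of "Min ((\<lambda>(z, w). dist z w) ` ?P)"])
      show "Min ((\<lambda>(z, w). dist z w) ` ?P) \<le> dist z w" if "(z, w) \<in> ?P" for z w
        using that fP by (intro Min_le) auto
      show "0 < Min ((\<lambda>(z, w). dist z w) ` ?P)"
        using False fP by (subst Min_gr_iff) auto
    qed
  next
    case True
    show thesis
    proof (rule that[of 1])
      show "1 \<le> dist z w" if "(z, w) \<in> ?P" for z w
        using that unfolding True by (rule emptyE)
    qed simp
  qed
  \<comment> \<open>The first bound keeps the points of \<open>X\<close> at distance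
    \<open>2 * r\<close>, the second keeps the slabs within relative width
    \<open>\<delta>\<close>.\<close>
  define r0 where "r0 = min (s / 2) (\<delta> * s / 2)"
  have "measure uniform_sphere {\<theta>. \<not> separated r \<theta>} \<le> \<kappa>"
    if r: "0 < r" "r \<le> r0" for r
  proof -
    have "2 * r \<le> \<delta> * s" using r by (simp add: r0_def)
    have "measure uniform_sphere {\<theta>. \<not> separated r \<theta>}
        \<le> measure uniform_sphere (\<Union>p\<in>?P. {\<theta>. \<bar>(fst p - snd p) \<bullet> \<theta>\<bar> < \<delta> * norm (fst p - snd p)})"
    proof (rule S.finite_measure_mono)
      show "{\<theta>. \<not> separated r \<theta>} \<subseteq> (\<Union>p\<in>?P. {\<theta>. \<bar>(fst p - snd p) \<bullet> \<theta>\<bar> < \<delta> * norm (fst p - snd p)})"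
      proof
        fix \<theta> assume "\<theta> \<in> {\<theta>. \<not> separated r \<theta>}"
        then obtain z w where p: "(z, w) \<in> ?P" "\<bar>(z - w) \<bullet> \<theta>\<bar> < 2 * r"
          by (auto simp: separated_def not_le)
        have "\<delta> * s \<le> \<delta> * norm (z - w)"
          using s(2)[OF p(1)] \<delta> by (simp add: dist_norm)
        then have "\<bar>(z - w) \<bullet> \<theta>\<bar> < \<delta> * norm (z - w)"
          using p(2) \<open>2 * r \<le> \<delta> * s\<close> by linarith
        then show "\<theta> \<in> (\<Union>p\<in>?P. {\<theta>. \<bar>(fst p - snd p) \<bullet> \<theta>\<bar> < \<delta> * norm (fst p - snd p)})"
          using p(1) by force
      qed
    qed (use fP in \<open>auto intro!: sets.finite_UN\<close>)
    also have "\<dots> \<le> (\<Sum>p\<in>?P. measure uniform_sphere {\<theta>. \<bar>(fst p - snd p) \<bullet> \<theta>\<bar> < \<delta> * norm (fst p - snd p)})"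
      by (rule S.finite_measure_subadditive_finite) (use fP in auto)
    also have "\<dots> \<le> (\<Sum>p\<in>?P. \<kappa> / (card ?P + 1))"
      by (intro sum_mono slab)
    also have "\<dots> = card ?P * (\<kappa> / (card ?P + 1))" by simp
    also have "\<dots> \<le> \<kappa>" using assms by (simp add: field_simps)
    finally show ?thesis .
  qed
  moreover have "2 * r \<le> dist z w" if "r \<le> r0" "z \<in> X" "w \<in> X" "z \<noteq> w" for r z w
    using s(2)[of z w] that by (auto simp: r0_def)
  ultimately show ?thesis
    using s(1) \<delta> by (intro exI[of _ r0]) (auto simp: r0_def)
qed

text \<open>What \<open>ball z r\<close> lacks compared with \<open>measure \<mu> {z}\<close> lies
  outside all balls or is an excess in the other balls; both are of order \<open>SW^2\<close>.
  Conversely, the balls are disjoint and the atoms have total mass 1, so one ball gains at most what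
  the others lose. \<open>C\<close> depends on \<open>r\<close> but not on
  \<open>\<nu>\<close>.\<close>

lemma measure_ball_bounds:
  assumes "r > 0" and sep: "measure uniform_sphere {\<theta>. \<not> separated r \<theta>} \<le> 1 / 2"
    and disj: "\<And>z w. z \<in> X \<Longrightarrow> w \<in> X \<Longrightarrow> z \<noteq> w \<Longrightarrow> 2 * r \<le> dist z w"
  shows "\<exists>C\<ge>0. \<forall>\<nu>\<in>P2. \<forall>z\<in>X.
    \<bar>measure \<nu> (ball z r) - measure \<mu> {z}\<bar> \<le> C * (sliced_wasserstein \<mu> \<nu>)\<^sup>2"
proof -
  interpret S: prob_space "uniform_sphere :: 'a measure" by (rule prob_space_uniform_sphere)
  interpret M: prob_space \<mu> using P2 by (simp add: P2_def)
  have half: "1 / 2 \<le> measure uniform_sphere {\<theta>. separated r \<theta>}"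
    using sep S.prob_neg[of "separated r"] by (simp add: uniform_sphere_def)
  obtain \<delta> where \<delta>: "\<delta> > 0"
    and slab: "\<And>u::'a. measure uniform_sphere {\<theta>. \<bar>u \<bullet> \<theta>\<bar> < \<delta> * norm u} \<le> 1 / (2 * card X)"
    using uniform_sphere_small_slab_uniform[of "1 / (2 * card X)"] finite nonempty
    by (auto simp: card_gt_0_iff)
  define C where "C = 2 / (\<delta> * r)\<^sup>2 + 2 / r\<^sup>2"
  have C: "0 \<le> C" by (simp add: C_def)
  have lower: "measure \<mu> {z} - measure \<nu> (ball z r) \<le> C * (sliced_wasserstein \<mu> \<nu>)\<^sup>2"
    if \<nu>: "\<nu> \<in> P2" and z: "z \<in> X" for \<nu> z
  proof -
    interpret N: prob_space \<nu> using \<nu> by (simp add: P2_def)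
    have sN: "sets \<nu> = sets borel" using \<nu> by (simp add: P2_def)
    define s where "s = (sliced_wasserstein \<mu> \<nu>)\<^sup>2"
    define U where "U = (\<Union>w\<in>X-{z}. ball w r)"
    define A where "A = {y. \<forall>z\<in>X. r \<le> dist z y}"
    have U: "U \<in> sets \<nu>" unfolding sN U_def by (intro borel_open open_UN) auto
    have "A = (\<Inter>z\<in>X. {y. r \<le> dist z y})" by (auto simp: A_def)
    moreover have "closed \<dots>"
      by (intro closed_INT ballI closed_Collect_le continuous_intros)
    ultimately have A: "A \<in> sets \<nu>" unfolding sN by (simp add: borel_closed)
    have "UNIV = ball z r \<union> U \<union> A"
      using z by (auto simp: U_def A_def not_le)
    then have "1 = measure \<nu> (ball z r \<union> U \<union> A)"
      using N.prob_space space_P2[OF \<nu>] by simp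
    also have "\<dots> \<le> measure \<nu> (ball z r) + measure \<nu> U + measure \<nu> A"
      using U A sN by (intro order_trans[OF measure_Un_le] add_right_mono measure_Un_le) auto
    finally have 1: "1 \<le> measure \<nu> (ball z r) + measure \<nu> U + measure \<nu> A" .
    have div: "a \<le> 2 / c * s" if "c * a \<le> 2 * s" "0 < c" for a c :: real
      using that by (simp add: field_simps)
    have "measure \<nu> A \<le> 2 / (\<delta> * r)\<^sup>2 * s"
      using measure_outside_le[OF \<nu> \<open>r > 0\<close> \<delta> slab] \<delta> \<open>r > 0\<close>
      by (intro div) (auto simp: A_def s_def)
    moreover have "measure \<nu> U - (1 - measure \<mu> {z}) \<le> 2 / r\<^sup>2 * s"
      using measure_other_balls_le[OF \<nu> \<open>r > 0\<close> z half] \<open>r > 0\<close>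
      by (intro div) (auto simp: U_def s_def)
    ultimately show ?thesis
      using 1 unfolding C_def s_def[symmetric] by (simp add: algebra_simps)
  qed
  have total: "(\<Sum>z\<in>X. measure \<mu> {z}) = 1"
  proof -
    have "ennreal 1 = (\<Sum>z\<in>X. ennreal (measure \<mu> {z}))"
      using nn_integral_eq_sum[of "\<lambda>_. 1"] M.emeasure_space_1 by simp
    also have "\<dots> = ennreal (\<Sum>z\<in>X. measure \<mu> {z})"
      by (rule sum_ennreal) simp
    finally show ?thesis
      by (subst (asm) ennreal_inj) (auto intro: sum_nonneg)
  qed
  have upper: "measure \<nu> (ball z r) - measure \<mu> {z} \<le> card X * C * (sliced_wasserstein \<mu> \<nu>)\<^sup>2"
    if \<nu>: "\<nu> \<in> P2" and z: "z \<in> X" for \<nu> z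
  proof -
    interpret N: prob_space \<nu> using \<nu> by (simp add: P2_def)
    have sN: "sets \<nu> = sets borel" using \<nu> by (simp add: P2_def)
    define s where "s = (sliced_wasserstein \<mu> \<nu>)\<^sup>2"
    have "disjoint_family_on (\<lambda>w. ball w r) X"
      unfolding disjoint_family_on_def
    proof (intro ballI impI)
      fix z w assume "z \<in> X" "w \<in> X" "z \<noteq> w"
      then have "2 * r \<le> dist z w" by (rule disj)
      then show "ball z r \<inter> ball w r = {}"
        by (intro disjoint_ballI) linarith
    qed
    then have "(\<Sum>w\<in>X. measure \<nu> (ball w r)) = measure \<nu> (\<Union>w\<in>X. ball w r)"
      by (rule N.finite_measure_finite_Union[OF finite _, symmetric, rotated]) (simp add: sN image_subset_iff)
    also have "\<dots> \<le> (\<Sum>w\<in>X. measure \<mu> {w})"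
      unfolding total by (rule N.prob_le_1)
    finally have "(\<Sum>w\<in>X. measure \<nu> (ball w r) - measure \<mu> {w}) \<le> 0"
      by (simp add: sum_subtractf)
    \<comment> \<open>The deviations sum to at most zero, so the one at \<open>z\<close> is
      controlled by the shortfalls elsewhere.\<close>
    then have "measure \<nu> (ball z r) - measure \<mu> {z}
        \<le> (\<Sum>w\<in>X-{z}. measure \<mu> {w} - measure \<nu> (ball w r))"
      unfolding sum.remove[OF finite z] sum_subtractf by linarith
    also have "\<dots> \<le> (\<Sum>w\<in>X-{z}. C * s)"
      unfolding s_def using lower[OF \<nu>] by (intro sum_mono) simp
    also have "\<dots> \<le> (\<Sum>w\<in>X. C * s)"
      using C by (intro sum_mono2[OF finite]) (auto simp: s_def)
    also have "\<dots> = card X * C * s" by simp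
    finally show ?thesis unfolding s_def .
  qed
  show ?thesis
  proof (intro exI[of _ "card X * C"] conjI ballI)
    fix \<nu> :: "'a measure" and z assume \<nu>: "\<nu> \<in> P2" and z: "z \<in> X"
    have "1 * C \<le> card X * C"
      using C finite nonempty by (intro mult_right_mono) (auto simp: Suc_le_eq card_gt_0_iff)
    then have "1 * C * (sliced_wasserstein \<mu> \<nu>)\<^sup>2 \<le> card X * C * (sliced_wasserstein \<mu> \<nu>)\<^sup>2"
      by (rule mult_right_mono) simp
    then show "\<bar>measure \<nu> (ball z r) - measure \<mu> {z}\<bar> \<le> card X * C * (sliced_wasserstein \<mu> \<nu>)\<^sup>2"
      using lower[OF \<nu> z] upper[OF \<nu> z] by (simp add: abs_le_iff)
  qed (use C in simp)
qed

section \<open>Upper bound for the decrease of the energy\<close>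

text \<open>In \<open>ball z r\<close>, the lower tangent bound and Young's inequality give
  \<open>V z \<le> V y + t^2 / (2 * \<tau>) + \<tau> / 2 * (g z)^2\<close> for
  \<open>t = norm (y - z)\<close>; off the balls the left-hand integrand vanishes. Integrate against
  \<open>\<nu>\<close>. The parameter \<open>\<tau>\<close> stays free and is tuned to the distance
  later.\<close>

lemma local_energy_le:
  fixes V g :: "'a \<Rightarrow> real"
  assumes \<nu>: "\<nu> \<in> P2" and [measurable]: "V \<in> borel_measurable borel" and V: "\<And>y. 0 \<le> V y"
    and disj: "\<And>z w. z \<in> X \<Longrightarrow> w \<in> X \<Longrightarrow> z \<noteq> w \<Longrightarrow> 2 * r \<le> dist z w"
    and slope: "\<And>z y. z \<in> X \<Longrightarrow> dist z y < r \<Longrightarrow> V z - g z * dist z y \<le> V y"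
    and "\<tau> > 0"
  shows "ennreal (\<Sum>z\<in>X. V z * measure \<nu> (ball z r)) \<le> (\<integral>\<^sup>+ y. ennreal (V y) \<partial>\<nu>)
    + ennreal (enn2real (local_cost r \<nu>) / (2 * \<tau>) + \<tau> / 2 * (\<Sum>z\<in>X. (g z)\<^sup>2 * measure \<nu> (ball z r)))"
proof -
  interpret N: prob_space \<nu> using \<nu> by (simp add: P2_def)
  have sN: "sets \<nu> = sets borel" using \<nu> by (simp add: P2_def)
  have [measurable]: "ball z r \<in> sets borel" for z :: 'a by simp
  have sum_eq: "(\<integral>\<^sup>+ y. (\<Sum>z\<in>X. ennreal (f z) * indicator (ball z r) y) \<partial>\<nu>)
      = ennreal (\<Sum>z\<in>X. f z * measure \<nu> (ball z r))" if "\<And>z. 0 \<le> f z" for f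
    using that sN
    by (subst nn_integral_sum) (auto simp: measurable_P2[OF \<nu>] nn_integral_cmult_indicator
      N.emeasure_eq_measure ennreal_mult[symmetric] sum_nonneg)
  let ?c = "\<lambda>y. \<Sum>z\<in>X. ennreal ((norm (y - z))\<^sup>2) * indicator (ball z r) y"
  let ?k = "\<lambda>y. \<Sum>z\<in>X. ennreal ((g z)\<^sup>2) * indicator (ball z r) y"
  have "ennreal (\<Sum>z\<in>X. V z * measure \<nu> (ball z r))
      = (\<integral>\<^sup>+ y. (\<Sum>z\<in>X. ennreal (V z) * indicator (ball z r) y) \<partial>\<nu>)"
    using V by (simp add: sum_eq)
  also have "\<dots> \<le> (\<integral>\<^sup>+ y. ennreal (V y) + (ennreal (1 / (2 * \<tau>)) * ?c y + ennreal (\<tau> / 2) * ?k y) \<partial>\<nu>)"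
  proof (rule nn_integral_mono)
    fix y
    show "(\<Sum>z\<in>X. ennreal (V z) * indicator (ball z r) y)
        \<le> ennreal (V y) + (ennreal (1 / (2 * \<tau>)) * ?c y + ennreal (\<tau> / 2) * ?k y)"
    proof (cases "\<exists>z\<in>X. dist z y < r")
      case True
      then obtain z where z: "z \<in> X" "dist z y < r" by auto
      \<comment> \<open>The balls are disjoint, so each of the three sums reduces to its term at
        \<open>z\<close>.\<close>
      have single: "(\<Sum>w\<in>X. f w * indicator (ball w r) y) = f z" for f :: "'a \<Rightarrow> ennreal"
      proof -
        have "\<not> dist w y < r" if "w \<in> X" "w \<noteq> z" for w
          using disj[OF that(1) z(1) that(2)] z(2) dist_triangle2[of w z y] by (simp add: dist_commute)
        then have "(\<Sum>w\<in>X. f w * indicator (ball w r) y) = (\<Sum>w\<in>X. if w = z then f z else 0)"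
          using z by (intro sum.cong) (auto simp: indicator_def)
        then show ?thesis using z finite by simp
      qed
      define t where "t = norm (y - z)"
      have "V z \<le> V y + g z * t"
        using slope[OF z] by (simp add: t_def dist_norm norm_minus_commute)
      also have "g z * t \<le> 1 / (2 * \<tau>) * t\<^sup>2 + \<tau> / 2 * (g z)\<^sup>2"
      proof -
        have "0 \<le> (t - \<tau> * g z)\<^sup>2 / (2 * \<tau>)" using \<open>\<tau> > 0\<close> by simp
        then show ?thesis using \<open>\<tau> > 0\<close> by (simp add: power2_eq_square field_simps)
      qed
      finally have "ennreal (V z) \<le> ennreal (V y + (1 / (2 * \<tau>) * t\<^sup>2 + \<tau> / 2 * (g z)\<^sup>2))"
        by (intro ennreal_leI) simp
      then show ?thesis
        unfolding single using V \<open>\<tau> > 0\<close>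
        by (simp add: t_def ennreal_mult[symmetric] ennreal_plus[symmetric] del: ennreal_plus)
    next
      case False
      then have "(\<Sum>z\<in>X. ennreal (V z) * indicator (ball z r) y) = 0"
        by (intro sum.neutral) (auto simp: indicator_def)
      then show ?thesis by simp
    qed
  qed
  also have "\<dots> = (\<integral>\<^sup>+ y. ennreal (V y) \<partial>\<nu>)
      + (ennreal (1 / (2 * \<tau>)) * (\<integral>\<^sup>+ y. ?c y \<partial>\<nu>) + ennreal (\<tau> / 2) * (\<integral>\<^sup>+ y. ?k y \<partial>\<nu>))"
    by (subst nn_integral_add, simp add: measurable_P2[OF \<nu>], simp add: measurable_P2[OF \<nu>],
      subst nn_integral_add, simp add: measurable_P2[OF \<nu>], simp add: measurable_P2[OF \<nu>],
      subst (1 2) nn_integral_cmult) (simp_all add: measurable_P2[OF \<nu>])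
  also have "(\<integral>\<^sup>+ y. ?k y \<partial>\<nu>) = ennreal (\<Sum>z\<in>X. (g z)\<^sup>2 * measure \<nu> (ball z r))"
    by (rule sum_eq) simp
  also have "(\<integral>\<^sup>+ y. ?c y \<partial>\<nu>) = ennreal (enn2real (local_cost r \<nu>))"
    using local_cost_finite[OF \<nu>, of r] by (simp add: local_cost_def)
  also have "ennreal (1 / (2 * \<tau>)) * ennreal (enn2real (local_cost r \<nu>))
      + ennreal (\<tau> / 2) * ennreal (\<Sum>z\<in>X. (g z)\<^sup>2 * measure \<nu> (ball z r))
      = ennreal (enn2real (local_cost r \<nu>) / (2 * \<tau>) + \<tau> / 2 * (\<Sum>z\<in>X. (g z)\<^sup>2 * measure \<nu> (ball z r)))"
    using \<open>\<tau> > 0\<close> by (simp add: ennreal_mult[symmetric] ennreal_plus[symmetric] sum_nonneg del: ennreal_plus)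
  finally show ?thesis .
qed

text \<open>The bound is stated for every small \<open>t \<ge> SW\<close> rather than for
  \<open>SW\<close> itself. This covers \<open>t = W / sqrt d\<close>, for the slope of
  \<open>W\<close>, and \<open>t \<rightarrow> 0\<close> at measures with \<open>SW = 0\<close>. The
  local cost is at most about \<open>d * t^2\<close>, and Young's inequality with the right
  parameter turns it into \<open>sqrt d * S * t\<close>.\<close>

lemma potential_upper:
  fixes V g :: "'a \<Rightarrow> real"
  assumes [measurable]: "V \<in> borel_measurable borel" and V: "\<And>y. 0 \<le> V y" and g: "\<And>z. 0 \<le> g z"
    and slope: "\<And>\<eta>. \<eta> > 0 \<Longrightarrow>
      \<exists>r>0. \<forall>z\<in>X. \<forall>y. dist z y < r \<longrightarrow> V z - (g z + \<eta>) * dist z y \<le> V y"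
    and "\<epsilon> > 0"
  defines "S \<equiv> sqrt (\<Sum>z\<in>X. (g z)\<^sup>2 * measure \<mu> {z})"
  shows "\<exists>\<delta>>0. \<forall>\<nu>\<in>P2. \<forall>t. 0 < t \<longrightarrow> t < \<delta> \<longrightarrow> sliced_wasserstein \<mu> \<nu> \<le> t \<longrightarrow>
    (\<integral>\<^sup>+ y. ennreal (V y) \<partial>\<mu>) \<le> (\<integral>\<^sup>+ y. ennreal (V y) \<partial>\<nu>) + ennreal ((sqrt DIM('a) * S + \<epsilon>) * t)"
proof -
  define d where "d = real DIM('a)"
  have d: "d > 0" by (simp add: d_def)
  have S: "0 \<le> S" "S\<^sup>2 = (\<Sum>z\<in>X. (g z)\<^sup>2 * measure \<mu> {z})"
    by (simp_all add: S_def sum_nonneg)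
  \<comment> \<open>All errors are expressed by \<open>e\<close>: this is the coefficient of
    \<open>t\<close> reached at the end, and it tends to \<open>sqrt d * S\<close>.\<close>
  have "((\<lambda>e. sqrt d * (S + e) * (1 + e / 2) + e) \<longlongrightarrow> sqrt d * (S + 0) * (1 + 0 / 2) + 0) (at_right 0)"
    by (intro tendsto_intros) simp
  then have "\<forall>\<^sub>F e in at_right 0. sqrt d * (S + e) * (1 + e / 2) + e < sqrt d * S + \<epsilon>"
    by (rule order_tendstoD) (use \<open>\<epsilon> > 0\<close> in simp)
  then obtain e where e: "e > 0" "sqrt d * (S + e) * (1 + e / 2) + e < sqrt d * S + \<epsilon>"
    using eventually_happens'[OF trivial_limit_at_right_real
        eventually_conj[OF _ eventually_at_right_less[of 0]]] by blast
  \<comment> \<open>\<open>K\<close> exceeds \<open>S\<close> to leave room for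
    \<open>\<eta>\<close> and for the mass errors, and it is positive even if \<open>S = 0\<close>,
    as the choice of \<open>\<tau>\<close> requires.\<close>
  define K where "K = S + e"
  have K: "K > 0" using S e by (simp add: K_def)
  have "S\<^sup>2 < K\<^sup>2" using S e by (intro power_strict_mono) (auto simp: K_def)
  have "((\<lambda>\<eta>. \<Sum>z\<in>X. (g z + \<eta>)\<^sup>2 * measure \<mu> {z}) \<longlongrightarrow> (\<Sum>z\<in>X. (g z + 0)\<^sup>2 * measure \<mu> {z})) (at_right 0)"
    by (intro tendsto_intros)
  then have "\<forall>\<^sub>F \<eta> in at_right 0. (\<Sum>z\<in>X. (g z + \<eta>)\<^sup>2 * measure \<mu> {z}) < K\<^sup>2"
    by (rule order_tendstoD) (use \<open>S\<^sup>2 < K\<^sup>2\<close> S in simp)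
  then obtain \<eta> where \<eta>: "\<eta> > 0" "(\<Sum>z\<in>X. (g z + \<eta>)\<^sup>2 * measure \<mu> {z}) < K\<^sup>2"
    using eventually_happens'[OF trivial_limit_at_right_real
        eventually_conj[OF _ eventually_at_right_less[of 0]]] by blast
  define h where "h z = g z + \<eta>" for z
  define T where "T = (\<Sum>z\<in>X. (h z)\<^sup>2 * measure \<mu> {z})"
  have T: "T < K\<^sup>2" using \<eta> by (simp add: T_def h_def)
  \<comment> \<open>The first bound serves \<open>measure_ball_bounds\<close>. The second gives
    \<open>d * \<kappa> \<le> e / (1 + e)\<close>, so that the local cost can be absorbed at the
    price of a factor \<open>1 + e\<close>.\<close>
  define \<kappa> where "\<kappa> = min (1 / 2) (e / (d * (1 + e)))"
  have "\<kappa> > 0" using e d by (simp add: \<kappa>_def)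
  obtain r0 where r0: "r0 > 0" "\<And>r. 0 < r \<Longrightarrow> r \<le> r0 \<Longrightarrow>
      measure uniform_sphere {\<theta>. \<not> separated r \<theta>} \<le> \<kappa> \<and> (\<forall>z\<in>X. \<forall>w\<in>X. z \<noteq> w \<longrightarrow> 2 * r \<le> dist z w)"
    using separated_eventually[OF \<open>\<kappa> > 0\<close>] by blast
  obtain r1 where r1: "r1 > 0" "\<And>z y. z \<in> X \<Longrightarrow> dist z y < r1 \<Longrightarrow> V z - h z * dist z y \<le> V y"
    using slope[OF \<eta>(1)] unfolding h_def by blast
  define r where "r = min r0 r1"
  have r: "r > 0" using r0 r1 by (simp add: r_def)
  have bad: "measure uniform_sphere {\<theta>. \<not> separated r \<theta>} \<le> \<kappa>"
    and disj: "\<And>z w. z \<in> X \<Longrightarrow> w \<in> X \<Longrightarrow> z \<noteq> w \<Longrightarrow> 2 * r \<le> dist z w"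
    using r0(2)[of r] r by (auto simp: r_def)
  have slope': "\<And>z y. z \<in> X \<Longrightarrow> dist z y < r \<Longrightarrow> V z - h z * dist z y \<le> V y"
    using r1 by (simp add: r_def)
  have "measure uniform_sphere {\<theta>. \<not> separated r \<theta>} \<le> 1 / 2"
    using bad by (simp add: \<kappa>_def)
  then obtain C where C: "C \<ge> 0"
    and balls: "\<And>\<nu> z. \<nu> \<in> P2 \<Longrightarrow> z \<in> X \<Longrightarrow>
      \<bar>measure \<nu> (ball z r) - measure \<mu> {z}\<bar> \<le> C * (sliced_wasserstein \<mu> \<nu>)\<^sup>2"
    using measure_ball_bounds[OF r _ disj] by blast
  define G where "G = (\<Sum>z\<in>X. (h z)\<^sup>2)"
  define Q where "Q = (\<Sum>z\<in>X. V z)"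
  have "((\<lambda>t. T + C * t\<^sup>2 * G) \<longlongrightarrow> T + C * 0\<^sup>2 * G) (at_right 0)"
    by (intro tendsto_intros)
  then have ev1: "\<forall>\<^sub>F t in at_right 0. T + C * t\<^sup>2 * G < K\<^sup>2"
    by (rule order_tendstoD) (use T in simp)
  have "((\<lambda>t. C * t * Q) \<longlongrightarrow> C * 0 * Q) (at_right 0)"
    by (intro tendsto_intros)
  then have ev2: "\<forall>\<^sub>F t in at_right 0. C * t * Q < e"
    by (rule order_tendstoD) (use e in simp)
  \<comment> \<open>Below \<open>\<delta>\<close>, mass deviations of order \<open>t^2\<close>
    neither push the weighted squared slopes above \<open>K^2\<close> nor contribute more than
    \<open>e * t\<close> to the energy.\<close>
  obtain \<delta> where \<delta>: "\<delta> > 0" "\<And>t. 0 < t \<Longrightarrow> t < \<delta> \<Longrightarrow> T + C * t\<^sup>2 * G < K\<^sup>2 \<and> C * t * Q < e"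
    using eventually_conj[OF ev1 ev2] by (auto simp: eventually_at_right[of "0::real" 1])
  show ?thesis
  proof (intro exI[of _ \<delta>] conjI ballI allI impI \<delta>(1))
    fix \<nu> :: "'a measure" and t :: real
    assume \<nu>: "\<nu> \<in> P2" and t: "0 < t" "t < \<delta>" and st: "sliced_wasserstein \<mu> \<nu> \<le> t"
    define s where "s = sliced_wasserstein \<mu> \<nu>"
    \<comment> \<open>This balances \<open>d * t^2 / (2 * \<tau>)\<close> against
      \<open>\<tau> / 2 * K^2\<close>: both equal \<open>sqrt d * K * t / 2\<close>.\<close>
    define \<tau> where "\<tau> = t * sqrt d / K"
    define D where "D = enn2real (local_cost r \<nu>)"
    have \<tau>: "\<tau> > 0" using t d K by (simp add: \<tau>_def)
    have "s\<^sup>2 \<le> t\<^sup>2"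
      using st sliced_wasserstein_nonneg[of \<mu> \<nu>] by (intro power_mono) (auto simp: s_def)
    have D0: "0 \<le> D" by (simp add: D_def)
    have "D \<le> d * s\<^sup>2 + d * \<kappa> * D"
      using local_cost_le[OF \<nu> bad] by (simp add: D_def s_def d_def)
    also have "d * \<kappa> \<le> e / (1 + e)"
    proof -
      have "d * \<kappa> \<le> d * (e / (d * (1 + e)))"
        using d by (intro mult_left_mono) (auto simp: \<kappa>_def)
      then show ?thesis using d by simp
    qed
    also have "d * s\<^sup>2 \<le> d * t\<^sup>2" using d \<open>s\<^sup>2 \<le> t\<^sup>2\<close> by simp
    finally have "D \<le> d * t\<^sup>2 + e / (1 + e) * D" using D0 by (simp add: mult_right_mono)
    then have "(1 + e) * D \<le> (1 + e) * (d * t\<^sup>2 + e / (1 + e) * D)"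
      using e by (intro mult_left_mono) auto
    also have "\<dots> = (1 + e) * d * t\<^sup>2 + e * D" using e by (simp add: field_simps)
    finally have D: "D \<le> (1 + e) * d * t\<^sup>2" by (simp add: algebra_simps)
    have "D / (2 * \<tau>) \<le> ((1 + e) * d * t\<^sup>2) / (2 * \<tau>)"
      using D \<tau> by (intro divide_right_mono) auto
    also have "\<dots> = sqrt d * K * (1 + e) / 2 * t"
    proof -
      have "((1 + e) * b\<^sup>2 * t\<^sup>2) / (2 * (t * b / K)) = b * K * (1 + e) / 2 * t" if "b > 0" for b
        using that t K by (simp add: power2_eq_square field_simps)
      from this[of "sqrt d"] show ?thesis using d by (simp add: \<tau>_def)
    qed
    finally have 1: "D / (2 * \<tau>) \<le> sqrt d * K * (1 + e) / 2 * t" .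
    have N: "\<bar>measure \<nu> (ball z r) - measure \<mu> {z}\<bar> \<le> C * t\<^sup>2" if "z \<in> X" for z
    proof -
      have "C * s\<^sup>2 \<le> C * t\<^sup>2" using C \<open>s\<^sup>2 \<le> t\<^sup>2\<close> by (rule mult_left_mono[rotated])
      then show ?thesis using balls[OF \<nu> that] by (simp add: s_def)
    qed
    have "(\<Sum>z\<in>X. (h z)\<^sup>2 * measure \<nu> (ball z r)) \<le> (\<Sum>z\<in>X. (h z)\<^sup>2 * (measure \<mu> {z} + C * t\<^sup>2))"
      using N by (intro sum_mono mult_left_mono) (auto simp: abs_le_iff algebra_simps)
    also have "\<dots> = T + C * t\<^sup>2 * G"
      by (simp add: T_def G_def distrib_left sum.distrib sum_distrib_left ac_simps)
    also have "\<dots> \<le> K\<^sup>2" using \<delta>(2)[OF t] by simp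
    finally have "\<tau> / 2 * (\<Sum>z\<in>X. (h z)\<^sup>2 * measure \<nu> (ball z r)) \<le> \<tau> / 2 * K\<^sup>2"
      using \<tau> by (intro mult_left_mono) auto
    also have "\<dots> = sqrt d * K / 2 * t" using K by (simp add: \<tau>_def power2_eq_square field_simps)
    finally have 2: "\<tau> / 2 * (\<Sum>z\<in>X. (h z)\<^sup>2 * measure \<nu> (ball z r)) \<le> sqrt d * K / 2 * t" .
    have "(\<Sum>z\<in>X. V z * measure \<mu> {z}) \<le> (\<Sum>z\<in>X. V z * (measure \<nu> (ball z r) + C * t\<^sup>2))"
      using N V by (intro sum_mono mult_left_mono) (auto simp: abs_le_iff algebra_simps)
    also have "\<dots> = (\<Sum>z\<in>X. V z * measure \<nu> (ball z r)) + (C * t * Q) * t"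
      by (simp add: Q_def distrib_left sum.distrib sum_distrib_left sum_distrib_right power2_eq_square ac_simps)
    also have "(C * t * Q) * t \<le> e * t"
      using \<delta>(2)[OF t] t by (intro mult_right_mono) auto
    finally have 3: "(\<Sum>z\<in>X. V z * measure \<mu> {z}) \<le> (\<Sum>z\<in>X. V z * measure \<nu> (ball z r)) + e * t"
      by simp
    have "(\<integral>\<^sup>+ y. ennreal (V y) \<partial>\<mu>) = ennreal (\<Sum>z\<in>X. V z * measure \<mu> {z})"
      using V by (subst nn_integral_eq_sum) (auto simp: ennreal_mult[symmetric] sum_nonneg)
    also have "\<dots> \<le> ennreal ((\<Sum>z\<in>X. V z * measure \<nu> (ball z r)) + e * t)"
      using 3 by (rule ennreal_leI)
    also have "\<dots> = ennreal (\<Sum>z\<in>X. V z * measure \<nu> (ball z r)) + ennreal (e * t)"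
      using V e t by (intro ennreal_plus) (auto intro!: sum_nonneg)
    also have "\<dots> \<le> (\<integral>\<^sup>+ y. ennreal (V y) \<partial>\<nu>)
        + ennreal (D / (2 * \<tau>) + \<tau> / 2 * (\<Sum>z\<in>X. (h z)\<^sup>2 * measure \<nu> (ball z r))) + ennreal (e * t)"
      unfolding D_def by (intro add_right_mono local_energy_le \<nu> V disj slope' \<tau>) auto
    also have "\<dots> = (\<integral>\<^sup>+ y. ennreal (V y) \<partial>\<nu>)
        + ennreal (D / (2 * \<tau>) + \<tau> / 2 * (\<Sum>z\<in>X. (h z)\<^sup>2 * measure \<nu> (ball z r)) + e * t)"
    proof -
      have "0 \<le> D / (2 * \<tau>) + \<tau> / 2 * (\<Sum>z\<in>X. (h z)\<^sup>2 * measure \<nu> (ball z r))"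
        using D0 \<tau> by (intro add_nonneg_nonneg divide_nonneg_nonneg mult_nonneg_nonneg sum_nonneg) auto
      then show ?thesis using e t by (subst (2) ennreal_plus) (auto simp: add.assoc)
    qed
    also have "\<dots> \<le> (\<integral>\<^sup>+ y. ennreal (V y) \<partial>\<nu>) + ennreal ((sqrt DIM('a) * S + \<epsilon>) * t)"
    proof (intro add_left_mono ennreal_leI)
      have "D / (2 * \<tau>) + \<tau> / 2 * (\<Sum>z\<in>X. (h z)\<^sup>2 * measure \<nu> (ball z r)) + e * t
          \<le> sqrt d * K * (1 + e) / 2 * t + sqrt d * K / 2 * t + e * t"
        using 1 2 by (intro add_mono) auto
      also have "\<dots> = (sqrt d * (S + e) * (1 + e / 2) + e) * t"
        by (simp add: K_def field_simps)
      also have "\<dots> \<le> (sqrt d * S + \<epsilon>) * t"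
        using e t by (intro mult_right_mono) auto
      finally show "D / (2 * \<tau>) + \<tau> / 2 * (\<Sum>z\<in>X. (h z)\<^sup>2 * measure \<nu> (ball z r)) + e * t
          \<le> (sqrt DIM('a) * S + \<epsilon>) * t" by (simp add: d_def)
    qed
    finally show "(\<integral>\<^sup>+ y. ennreal (V y) \<partial>\<mu>)
        \<le> (\<integral>\<^sup>+ y. ennreal (V y) \<partial>\<nu>) + ennreal ((sqrt DIM('a) * S + \<epsilon>) * t)" .
  qed
qed

end

subsection \<open>Slopes\<close>

text \<open>As \<open>e u\<close> is finite, truncated subtraction in \<open>ennreal\<close> agrees
  with the positive part in \<open>metric_slope\<close>, including the value 0 at infinite energy.
  For \<open>K = 0\<close> the hypothesis \<open>lower\<close> is vacuous and the lower bound
  trivial.\<close>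

lemma metric_slope_eqI:
  fixes e :: "'x \<Rightarrow> ennreal" and m :: "'x \<Rightarrow> 'x \<Rightarrow> real"
  assumes fin: "e u < \<infinity>" and "0 \<le> K"
    and upper: "\<And>\<epsilon>. \<epsilon> > 0 \<Longrightarrow> \<exists>\<delta>>0. \<forall>v\<in>X. 0 < m u v \<longrightarrow> m u v < \<delta> \<longrightarrow>
      e u \<le> e v + ennreal ((K + \<epsilon>) * m u v)"
    and lower: "\<And>c \<delta>. 0 < c \<Longrightarrow> c < K \<Longrightarrow> 0 < \<delta> \<Longrightarrow>
      \<exists>v\<in>X. 0 < m u v \<and> m u v < \<delta> \<and> e v + ennreal (c * m u v) \<le> e u"
  shows "metric_slope X m (\<lambda>v. enn2ereal (e v)) u = ennreal K"
proof -
  let ?F = "inf (filtercomap (m u) (at_right 0)) (principal X)"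
  let ?f = "\<lambda>v. (e u - e v) / ennreal (m u v)"
  have "(if enn2ereal (e v) = \<infinity> then 0 else e2ennreal (max 0 (enn2ereal (e u) - enn2ereal (e v)))) = e u - e v" for v
  proof (cases "e v = \<infinity>")
    case False
    have "e2ennreal (max 0 (enn2ereal (e u) - enn2ereal (e v))) = e u - e v"
      by (simp add: minus_ennreal.rep_eq[symmetric] e2ennreal_enn2ereal)
    with False show ?thesis by simp
  qed (use fin in \<open>simp add: diff_eq_0_ennreal\<close>)
  then have slope: "metric_slope X m (\<lambda>v. enn2ereal (e v)) u = Limsup ?F ?f"
    by (simp add: metric_slope_def)
  \<comment> \<open>The filter in epsilon-delta form; \<open>at_right 0\<close> excludes points at
    distance 0 from \<open>u\<close>.\<close>
  have ev: "eventually P ?F \<longleftrightarrow> (\<exists>\<delta>>0. \<forall>v\<in>X. 0 < m u v \<longrightarrow> m u v < \<delta> \<longrightarrow> P v)" for P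
  proof
    assume "eventually P ?F"
    then obtain Q where Q: "eventually Q (at_right 0)" "\<And>v. Q (m u v) \<Longrightarrow> v \<in> X \<Longrightarrow> P v"
      by (auto simp: eventually_inf_principal eventually_filtercomap)
    then show "\<exists>\<delta>>0. \<forall>v\<in>X. 0 < m u v \<longrightarrow> m u v < \<delta> \<longrightarrow> P v"
      by (auto simp: eventually_at_right[of 0 1])
  next
    assume "\<exists>\<delta>>0. \<forall>v\<in>X. 0 < m u v \<longrightarrow> m u v < \<delta> \<longrightarrow> P v"
    then obtain \<delta> where "\<delta> > 0" "\<And>v. v \<in> X \<Longrightarrow> 0 < m u v \<Longrightarrow> m u v < \<delta> \<Longrightarrow> P v" by blast
    then show "eventually P ?F"
      unfolding eventually_inf_principal eventually_filtercomap
      by (intro exI[of _ "\<lambda>s. 0 < s \<and> s < \<delta>"]) (auto simp: eventually_at_right[of 0 1])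
  qed
  have "Limsup ?F ?f \<le> ennreal K"
  proof (rule ennreal_le_epsilon)
    fix \<epsilon> :: real assume \<epsilon>: "\<epsilon> > 0"
    have "\<forall>\<^sub>F v in ?F. ?f v \<le> ennreal (K + \<epsilon>)"
    proof -
      have "?f v \<le> ennreal (K + \<epsilon>)" if v: "0 < m u v" "e u \<le> e v + ennreal ((K + \<epsilon>) * m u v)" for v
      proof -
        have "e u - e v \<le> ennreal ((K + \<epsilon>) * m u v)"
          using v(2) fin by (auto simp: ennreal_minus_le_iff)
        then have "?f v \<le> ennreal ((K + \<epsilon>) * m u v) / ennreal (m u v)"
          by (rule divide_right_mono_ennreal)
        also have "\<dots> = ennreal (K + \<epsilon>)"
          using v(1) \<epsilon> \<open>0 \<le> K\<close> by (simp add: divide_ennreal)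
        finally show ?thesis .
      qed
      then show ?thesis unfolding ev using upper[OF \<epsilon>] by meson
    qed
    then have "Limsup ?F ?f \<le> ennreal (K + \<epsilon>)" by (rule Limsup_bounded)
    then show "Limsup ?F ?f \<le> ennreal K + ennreal \<epsilon>"
      using \<epsilon> \<open>0 \<le> K\<close> by simp
  qed
  moreover have "ennreal K \<le> Limsup ?F ?f"
  proof (rule ccontr)
    assume "\<not> ennreal K \<le> Limsup ?F ?f"
    then have less: "Limsup ?F ?f < ennreal K" by simp
    then obtain l where l: "Limsup ?F ?f = ennreal l" "0 \<le> l"
      by (cases "Limsup ?F ?f") auto
    then have "l < K" using less by (simp add: ennreal_less_iff)
    \<comment> \<open>The midpoint is below \<open>K\<close>, so \<open>lower\<close> supplies
      points with quotient at least \<open>c\<close>, and it is positive even for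
      \<open>l = 0\<close>.\<close>
    define c where "c = (l + K) / 2"
    have c: "0 < c" "c < K" "l < c" using \<open>l < K\<close> \<open>0 \<le> l\<close> by (auto simp: c_def)
    have "ennreal c \<le> Limsup ?F ?f"
      unfolding Limsup_def
    proof (rule INF_greatest)
      fix P assume "P \<in> {P. eventually P ?F}"
      then obtain \<delta> where \<delta>: "\<delta> > 0" "\<And>v. v \<in> X \<Longrightarrow> 0 < m u v \<Longrightarrow> m u v < \<delta> \<Longrightarrow> P v"
        unfolding mem_Collect_eq ev by blast
      obtain v where v: "v \<in> X" "0 < m u v" "m u v < \<delta>" "e v + ennreal (c * m u v) \<le> e u"
        using lower[OF c(1,2) \<delta>(1)] by blast
      have "e v < \<infinity>" using v(4) fin by (metis ennreal_add_eq_top infinity_ennreal_def leD less_top order_le_less_trans top.not_eq_extremum)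
      then have "ennreal (c * m u v) \<le> e u - e v"
        using v(4) by (metis add_diff_self_ennreal ennreal_add_diff_cancel_left ennreal_minus_mono infinity_ennreal_def less_irrefl order_refl)
      then have "ennreal (c * m u v) / ennreal (m u v) \<le> ?f v"
        by (rule divide_right_mono_ennreal)
      also have "ennreal (c * m u v) / ennreal (m u v) = ennreal c"
        using v(2) c(1) by (simp add: divide_ennreal)
      finally show "ennreal c \<le> (SUP v\<in>{v. P v}. ?f v)"
        using \<delta>(2)[OF v(1-3)] by (intro SUP_upper2[of v]) auto
    qed
    then show False using l c by simp
  qed
  ultimately show ?thesis unfolding slope by (rule antisym)
qed

section \<open>Competitors along the gradient and the two slopes\<close>

text \<open>Moving the mass \<open>m i\<close> from \<open>x i\<close> to \<open>y i\<close> is a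
  coupling: push the weights forward to the pairs.\<close>

lemma wasserstein_discrete_le:
  fixes x y :: "nat \<Rightarrow> 'a::euclidean_space"
  assumes m: "\<And>i. i \<in> {1..n} \<Longrightarrow> 0 \<le> m i" and one: "(\<Sum>i=1..n. m i) = 1"
  shows "wasserstein (discrete_measure n m x) (discrete_measure n m y)
    \<le> sqrt (\<Sum>i=1..n. m i * (dist (x i) (y i))\<^sup>2)"
proof -
  let ?p = "point_measure {1..n} (\<lambda>i. ennreal (m i))"
  let ?\<gamma> = "distr ?p borel (\<lambda>i. (x i, y i))"
  let ?\<mu> = "discrete_measure n m x" and ?\<nu> = "discrete_measure n m y"
  have P2: "?\<mu> \<in> P2" "?\<nu> \<in> P2"
    using assms by (auto intro: discrete_measure_in_P2)
  have "(\<Sum>i=1..n. ennreal (m i)) = 1"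
    using one by (subst sum_ennreal) (auto intro: m)
  then have "emeasure ?p (space ?p) = 1"
    by (simp add: space_point_measure emeasure_point_measure_finite)
  then have "prob_space ?p" by (rule prob_spaceI)
  then have "?\<gamma> \<in> couplings ?\<mu> ?\<nu>"
    by (auto simp: couplings_def discrete_measure_def distr_distr comp_def intro: prob_space.prob_space_distr)
  then have "transport_cost ?\<mu> ?\<nu> \<le> (\<integral>\<^sup>+ z. ennreal ((dist (fst z) (snd z))\<^sup>2) \<partial>?\<gamma>)"
    unfolding transport_cost_def by (rule INF_lower)
  also have "\<dots> = (\<integral>\<^sup>+ i. ennreal ((dist (x i) (y i))\<^sup>2) \<partial>?p)"
    by (subst nn_integral_distr) auto
  also have "\<dots> = ennreal (\<Sum>i=1..n. m i * (dist (x i) (y i))\<^sup>2)"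
    using m by (subst sum_ennreal[symmetric])
      (auto simp: nn_integral_point_measure_finite ennreal_mult mult.commute)
  finally have "ennreal ((wasserstein ?\<mu> ?\<nu>)\<^sup>2) \<le> \<dots>"
    unfolding wasserstein_power2[OF P2] .
  then have "(wasserstein ?\<mu> ?\<nu>)\<^sup>2 \<le> (\<Sum>i=1..n. m i * (dist (x i) (y i))\<^sup>2)"
    using m by (subst (asm) ennreal_le_iff) (auto intro: sum_nonneg)
  then show ?thesis by (rule real_le_rsqrt)
qed

lemma finite_support_discrete_measure:
  fixes x :: "nat \<Rightarrow> 'a::euclidean_space"
  assumes "\<And>i. i \<in> {1..n} \<Longrightarrow> 0 \<le> m i" and one: "(\<Sum>i=1..n. m i) = 1"
  shows "finite_support (discrete_measure n m x) (x ` {1..n})"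
proof
  show "discrete_measure n m x \<in> P2"
    using assms by (rule discrete_measure_in_P2)
  show "x ` {1..n} \<noteq> {}" using one by (cases n) auto
  have "{y. y \<in> x ` {1..n}} \<in> sets borel" by (simp add: borel_closed finite_imp_closed)
  then show "AE y in discrete_measure n m x. y \<in> x ` {1..n}"
    unfolding discrete_measure_def by (subst AE_distr_iff) (auto simp: AE_point_measure)
qed simp

text \<open>The energy of the atoms moved along \<open>- G\<close> has derivative
  \<open>- (\<Sum>i=1..n. m i * (norm (G (x i)))^2)\<close> at \<open>t = 0\<close>, so for small
  \<open>t\<close> it falls by more than \<open>c * t\<close>.\<close>

lemma gradient_lower:
  fixes V :: "'a::euclidean_space \<Rightarrow> real" and G :: "'a \<Rightarrow> 'a"
  assumes deriv: "\<And>z. (V has_derivative (\<lambda>h. G z \<bullet> h)) (at z)"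
    and c: "c < (\<Sum>i=1..n. m i * (norm (G (x i)))\<^sup>2)"
  shows "\<forall>\<^sub>F t in at_right 0.
    (\<Sum>i=1..n. V (x i - t *\<^sub>R G (x i)) * m i) + c * t < (\<Sum>i=1..n. V (x i) * m i)"
proof -
  let ?\<phi> = "\<lambda>t. \<Sum>i=1..n. V (x i - t *\<^sub>R G (x i)) * m i"
  let ?T = "\<Sum>i=1..n. m i * (norm (G (x i)))\<^sup>2"
  have "(?\<phi> has_derivative (\<lambda>s. - (s * ?T))) (at 0)"
  proof -
    have "((\<lambda>t. V (x i - t *\<^sub>R G (x i))) has_derivative (\<lambda>s. G (x i) \<bullet> (- (s *\<^sub>R G (x i))))) (at 0)" for i
    proof (rule has_derivative_compose[of "\<lambda>t. x i - t *\<^sub>R G (x i)"])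
      show "((\<lambda>t. x i - t *\<^sub>R G (x i)) has_derivative (\<lambda>s. - (s *\<^sub>R G (x i)))) (at 0)"
        by (auto intro!: derivative_eq_intros)
    qed (use deriv[of "x i"] in simp)
    then have "(?\<phi> has_derivative (\<lambda>s. \<Sum>i=1..n. G (x i) \<bullet> (- (s *\<^sub>R G (x i))) * m i)) (at 0)"
      by (intro has_derivative_sum has_derivative_mult_left)
    moreover have "(\<Sum>i=1..n. G (x i) \<bullet> (- (s *\<^sub>R G (x i))) * m i) = - (s * ?T)" for s
      by (simp add: sum_distrib_left sum_negf power2_norm_eq_inner ac_simps)
    ultimately show ?thesis by simp
  qed
  then have "(?\<phi> has_field_derivative (- ?T)) (at 0)"
    by (rule has_derivative_imp_has_field_derivative) simp
  then have "((\<lambda>t. (?\<phi> t - ?\<phi> 0) / t) \<longlongrightarrow> - ?T) (at 0)"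
    by (simp add: DERIV_def)
  then have "((\<lambda>t. (?\<phi> t - ?\<phi> 0) / t) \<longlongrightarrow> - ?T) (at_right 0)"
    by (rule tendsto_mono[OF at_le, rotated]) simp
  then have "\<forall>\<^sub>F t in at_right 0. (?\<phi> t - ?\<phi> 0) / t < - c"
    by (rule order_tendstoD) (use c in simp)
  then show ?thesis
    using eventually_at_right_less[of 0]
    by eventually_elim (simp add: field_simps)
qed

text \<open>When \<open>SW = 0\<close>, \<open>potential_upper\<close> applies to every small
  \<open>t > 0\<close>; let \<open>t\<close> tend to 0. Consequently a measure of strictly smaller
  energy is at positive sliced distance, which replaces the fact that \<open>SW\<close> separates
  measures.\<close>

lemma (in finite_support) potential_le_of_sliced_eq_0:
  fixes V g :: "'a \<Rightarrow> real"
  assumes "V \<in> borel_measurable borel" and "\<And>y. 0 \<le> V y" and "\<And>z. 0 \<le> g z"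
    and "\<And>\<eta>. \<eta> > 0 \<Longrightarrow> \<exists>r>0. \<forall>z\<in>X. \<forall>y. dist z y < r \<longrightarrow> V z - (g z + \<eta>) * dist z y \<le> V y"
    and \<nu>: "\<nu> \<in> P2" "sliced_wasserstein \<mu> \<nu> = 0"
  shows "(\<integral>\<^sup>+ y. ennreal (V y) \<partial>\<mu>) \<le> (\<integral>\<^sup>+ y. ennreal (V y) \<partial>\<nu>)"
proof (rule ennreal_le_epsilon)
  fix \<epsilon> :: real assume \<epsilon>: "\<epsilon> > 0"
  \<comment> \<open>The final 1 is the error \<open>\<epsilon> = 1\<close> in
    \<open>potential_upper\<close>; it keeps \<open>L\<close> positive when the rest
    vanishes.\<close>
  define L where "L = sqrt DIM('a) * sqrt (\<Sum>z\<in>X. (g z)\<^sup>2 * measure \<mu> {z}) + 1"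
  have L: "L > 0" by (auto simp: L_def intro!: add_nonneg_pos mult_nonneg_nonneg sum_nonneg)
  obtain \<delta> where \<delta>: "\<delta> > 0" "\<And>t. 0 < t \<Longrightarrow> t < \<delta> \<Longrightarrow>
      (\<integral>\<^sup>+ y. ennreal (V y) \<partial>\<mu>) \<le> (\<integral>\<^sup>+ y. ennreal (V y) \<partial>\<nu>) + ennreal (L * t)"
    using potential_upper[OF assms(1-4) zero_less_one] \<nu> unfolding L_def by fastforce
  define t where "t = min (\<delta> / 2) (\<epsilon> / L)"
  have t: "0 < t" "t < \<delta>" using \<delta>(1) \<epsilon> L by (auto simp: t_def)
  have "L * t \<le> \<epsilon>" using L by (auto simp: t_def min_def field_simps)
  then show "(\<integral>\<^sup>+ y. ennreal (V y) \<partial>\<mu>) \<le> (\<integral>\<^sup>+ y. ennreal (V y) \<partial>\<nu>) + ennreal \<epsilon>"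
    using \<delta>(2)[OF t] by (meson add_left_mono ennreal_leI order_trans)
qed

text \<open>First-order expansion at each \<open>z\<close>, Cauchy-Schwarz for the linear term, and
  the least of finitely many radii.\<close>

lemma potential_lower_tangent:
  fixes V :: "'a::euclidean_space \<Rightarrow> real" and G :: "'a \<Rightarrow> 'a"
  assumes deriv: "\<And>z. (V has_derivative (\<lambda>h. G z \<bullet> h)) (at z)"
    and "finite X" and "\<eta> > 0"
  shows "\<exists>r>0. \<forall>z\<in>X. \<forall>y. dist z y < r \<longrightarrow> V z - (norm (G z) + \<eta>) * dist z y \<le> V y"
proof -
  have "\<exists>r>0. \<forall>y. dist z y < r \<longrightarrow> V z - (norm (G z) + \<eta>) * dist z y \<le> V y" for z
  proof -
    obtain r where r: "r > 0" "\<And>y. norm (y - z) < r \<Longrightarrow> norm (V y - V z - G z \<bullet> (y - z)) \<le> \<eta> * norm (y - z)"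
      using deriv[of z] \<open>\<eta> > 0\<close> unfolding has_derivative_at_alt by blast
    have "V z - (norm (G z) + \<eta>) * dist z y \<le> V y" if "dist z y < r" for y
    proof -
      have "\<bar>G z \<bullet> (y - z)\<bar> \<le> norm (G z) * norm (y - z)" by (rule Cauchy_Schwarz_ineq2)
      then show ?thesis
        using r(2)[of y] that by (simp add: dist_norm norm_minus_commute algebra_simps abs_le_iff)
    qed
    with r(1) show ?thesis by blast
  qed
  then obtain r where r: "\<And>z. r z > 0"
    "\<And>z y. dist z y < r z \<Longrightarrow> V z - (norm (G z) + \<eta>) * dist z y \<le> V y"
    by metis
  show ?thesis
  proof (cases "X = {}")
    case False
    have "Min (r ` X) \<le> r z" if "z \<in> X" for z using that \<open>finite X\<close> by simp
    then have "V z - (norm (G z) + \<eta>) * dist z y \<le> V y" if "z \<in> X" "dist z y < Min (r ` X)" for z y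
      using that by (intro r(2)) force
    then show ?thesis
      using False \<open>finite X\<close> r(1) by (intro exI[of _ "Min (r ` X)"]) auto
  qed (auto intro: exI[of _ 1])
qed

text \<open>Riesz representation in the standard basis: the coordinates of \<open>G\<close> are
  evaluations of the derivative, hence continuous.\<close>

lemma continuously_differentiable_gradient:
  fixes V :: "'a::euclidean_space \<Rightarrow> real"
  assumes "continuously_differentiable V"
  obtains G where "\<And>z. (V has_derivative (\<lambda>h. G z \<bullet> h)) (at z)" "continuous_on UNIV G"
proof -
  obtain V' :: "'a \<Rightarrow> 'a \<Rightarrow>\<^sub>L real" where V': "\<And>z. (V has_derivative blinfun_apply (V' z)) (at z)"
    "continuous_on UNIV V'"
    using assms by (auto simp: continuously_differentiable_def)
  define G where "G z = (\<Sum>b\<in>Basis. blinfun_apply (V' z) b *\<^sub>R b)" for z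
  have "blinfun_apply (V' z) h = G z \<bullet> h" for z h
  proof -
    have "blinfun_apply (V' z) h = blinfun_apply (V' z) (\<Sum>b\<in>Basis. (h \<bullet> b) *\<^sub>R b)"
      by (simp add: euclidean_representation)
    also have "\<dots> = G z \<bullet> h"
      by (simp add: G_def blinfun.sum_right blinfun.scaleR_right inner_sum_left inner_commute[of h] mult.commute)
    finally show ?thesis .
  qed
  then have "blinfun_apply (V' z) = (\<lambda>h. G z \<bullet> h)" for z by auto
  moreover have "continuous_on UNIV G"
    unfolding G_def by (intro continuous_intros V'(2))
  ultimately show thesis
    using V'(1) by (intro that[of G]) auto
qed

text \<open>\<open>S\<close> is the norm of the gradient of \<open>V\<close> in the space L2 of the
  discrete measure. Each slope is computed separately from matching upper and lower bounds.\<close>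

lemma metric_slopes_discrete_measure:
  fixes V :: "'a::euclidean_space \<Rightarrow> real"
  assumes diff: "continuously_differentiable V" and V: "\<And>y. 0 \<le> V y"
    and m: "\<And>i. i \<in> {1..n} \<Longrightarrow> 0 \<le> m i" and one: "(\<Sum>i=1..n. m i) = 1"
  shows "\<exists>S\<ge>0. metric_slope P2 wasserstein (potential_energy V) (discrete_measure n m x) = ennreal S \<and>
    metric_slope P2 sliced_wasserstein (potential_energy V) (discrete_measure n m x)
      = ennreal (sqrt DIM('a) * S)"
proof -
  obtain G where deriv: "\<And>z. (V has_derivative (\<lambda>h. G z \<bullet> h)) (at z)" and G: "continuous_on UNIV G"
    using continuously_differentiable_gradient[OF diff] by blast
  define \<mu> where "\<mu> = discrete_measure n m x"
  define X where "X = x ` {1..n}"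
  define e where "e \<nu> = (\<integral>\<^sup>+ y. ennreal (V y) \<partial>\<nu>)" for \<nu> :: "'a measure"
  define d where "d = real DIM('a)"
  have d: "d > 0" by (simp add: d_def)
  interpret finite_support \<mu> X
    unfolding \<mu>_def X_def using m one by (rule finite_support_discrete_measure)
  have "continuous_on UNIV V"
    using deriv by (intro continuous_at_imp_continuous_on ballI has_derivative_continuous)
  then have Vm [measurable]: "V \<in> borel_measurable borel" by (rule borel_measurable_continuous_onI)
  have [measurable]: "G \<in> borel_measurable borel" using G by (rule borel_measurable_continuous_onI)
  note tangent = potential_lower_tangent[OF deriv finite]
  define S where "S = sqrt (\<Sum>z\<in>X. (norm (G z))\<^sup>2 * measure \<mu> {z})"
  have S0: "0 \<le> S" by (simp add: S_def sum_nonneg)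
  \<comment> \<open>The upper bound sums over distinct positions, the competitors over indices,
    where positions may repeat. Both sums are the integral of \<open>(norm (G z))^2\<close>.\<close>
  have S: "S\<^sup>2 = (\<Sum>i=1..n. m i * (norm (G (x i)))\<^sup>2)"
  proof -
    have "ennreal (S\<^sup>2) = (\<Sum>z\<in>X. ennreal ((norm (G z))\<^sup>2) * ennreal (measure \<mu> {z}))"
      by (simp add: S_def sum_nonneg ennreal_mult[symmetric])
    also have "\<dots> = (\<integral>\<^sup>+ z. ennreal ((norm (G z))\<^sup>2) \<partial>\<mu>)"
      by (rule nn_integral_eq_sum[symmetric]) simp
    also have "\<dots> = ennreal (\<Sum>i=1..n. m i * (norm (G (x i)))\<^sup>2)"
      unfolding \<mu>_def using m
      by (subst sum_ennreal[symmetric])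
        (auto simp: nn_integral_discrete_measure ennreal_mult mult.commute)
    finally show ?thesis
      using m by (subst (asm) ennreal_inj) (auto intro!: sum_nonneg)
  qed
  have e_discrete: "e (discrete_measure n m y) = ennreal (\<Sum>i=1..n. V (y i) * m i)" for y
    unfolding e_def using V m
    by (subst sum_ennreal[symmetric]) (auto simp: nn_integral_discrete_measure ennreal_mult)
  then have fin: "e \<mu> < \<infinity>" by (simp add: \<mu>_def)
  have upper: "\<exists>\<delta>>0. \<forall>\<nu>\<in>P2. \<forall>t. 0 < t \<longrightarrow> t < \<delta> \<longrightarrow> sliced_wasserstein \<mu> \<nu> \<le> t \<longrightarrow>
      e \<mu> \<le> e \<nu> + ennreal ((sqrt d * S + \<epsilon>) * t)" if "\<epsilon> > 0" for \<epsilon>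
    unfolding e_def d_def S_def by (rule potential_upper[OF Vm V norm_ge_zero tangent that])
  define y where "y t i = x i - t *\<^sub>R G (x i)" for t i
  define \<nu> where "\<nu> t = discrete_measure n m (y t)" for t
  have \<nu>: "\<nu> t \<in> P2" for t
    unfolding \<nu>_def using m one by (rule discrete_measure_in_P2)
  have W_le: "wasserstein \<mu> (\<nu> t) \<le> t * S" if "t > 0" for t
  proof -
    have "wasserstein \<mu> (\<nu> t) \<le> sqrt (\<Sum>i=1..n. m i * (dist (x i) (y t i))\<^sup>2)"
      unfolding \<mu>_def \<nu>_def using m one by (rule wasserstein_discrete_le)
    also have "(\<Sum>i=1..n. m i * (dist (x i) (y t i))\<^sup>2) = (t * S)\<^sup>2"
      unfolding power_mult_distrib S
      by (simp add: y_def dist_norm power_mult_distrib sum_distrib_left ac_simps)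
    finally show ?thesis using that S0 by simp
  qed
  \<comment> \<open>Common to both distances: \<open>q\<close> bounds the speed of
    \<open>\<nu> t\<close> in \<open>dst\<close>, so to first order the energy drops by at least
    \<open>S^2 / q > c\<close> per unit of distance. Here \<open>q\<close> is \<open>S\<close> for
    \<open>W\<close> and \<open>S / sqrt d\<close> for \<open>SW\<close>.\<close>
  have lower: "\<exists>\<nu>\<in>P2. 0 < dst \<mu> \<nu> \<and> dst \<mu> \<nu> < \<delta> \<and> e \<nu> + ennreal (c * dst \<mu> \<nu>) \<le> e \<mu>"
    if pos: "\<And>\<nu>. \<nu> \<in> P2 \<Longrightarrow> 0 < sliced_wasserstein \<mu> \<nu> \<Longrightarrow> 0 < dst \<mu> \<nu>"
      and le: "\<And>t. t > 0 \<Longrightarrow> dst \<mu> (\<nu> t) \<le> t * q" and q: "0 < q" "c * q < S\<^sup>2" and c: "0 < c" and \<delta>: "0 < \<delta>"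
    for dst :: "'a measure \<Rightarrow> 'a measure \<Rightarrow> real" and q c \<delta>
  proof -
    have "\<forall>\<^sub>F t in at_right 0. (\<Sum>i=1..n. V (y t i) * m i) + c * q * t < (\<Sum>i=1..n. V (x i) * m i)"
      unfolding y_def using q(2) unfolding S by (rule gradient_lower[OF deriv])
    moreover have "\<forall>\<^sub>F t in at_right 0. t < \<delta> / q"
      using \<delta> q by (intro eventually_mono[OF eventually_at_right_real[of 0 "\<delta> / q"]]) auto
    moreover have "\<forall>\<^sub>F t in at_right 0. (0::real) < t"
      by (rule eventually_at_right_less)
    ultimately have "\<forall>\<^sub>F t in at_right 0. 0 < t \<and> t < \<delta> / q \<and>
        (\<Sum>i=1..n. V (y t i) * m i) + c * q * t < (\<Sum>i=1..n. V (x i) * m i)"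
      by eventually_elim auto
    then obtain t where t: "0 < t" "t < \<delta> / q"
      "(\<Sum>i=1..n. V (y t i) * m i) + c * q * t < (\<Sum>i=1..n. V (x i) * m i)"
      using eventually_happens'[OF trivial_limit_at_right_real] by blast
    have nonneg: "0 \<le> (\<Sum>i=1..n. V (y t i) * m i)"
      using V m by (auto intro!: sum_nonneg)
    have "e (\<nu> t) < e \<mu>"
      unfolding \<nu>_def \<mu>_def e_discrete
      using t c q nonneg by (intro ennreal_lessI) (auto intro: le_less_trans[rotated] simp: add_strict_increasing)
    \<comment> \<open>Distance 0 would contradict the strict decrease of the energy.\<close>
    then have "sliced_wasserstein \<mu> (\<nu> t) \<noteq> 0"
      using potential_le_of_sliced_eq_0[OF Vm V norm_ge_zero tangent \<nu>, of t] by (auto simp: e_def not_le[symmetric])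
    then have p: "0 < dst \<mu> (\<nu> t)"
      using sliced_wasserstein_nonneg[of \<mu> "\<nu> t"] by (intro pos \<nu>) auto
    have "t * q < \<delta>" using t q by (simp add: field_simps)
    have "c * dst \<mu> (\<nu> t) \<le> c * q * t"
      using mult_left_mono[OF le[OF t(1)], of c] c by (simp add: ac_simps)
    then have "ennreal ((\<Sum>i=1..n. V (y t i) * m i) + c * dst \<mu> (\<nu> t)) \<le> e \<mu>"
      unfolding \<mu>_def[symmetric] e_discrete[of x, folded \<mu>_def] using t by (intro ennreal_leI) simp
    then have "e (\<nu> t) + ennreal (c * dst \<mu> (\<nu> t)) \<le> e \<mu>"
      unfolding \<nu>_def e_discrete using nonneg p c by (simp add: \<nu>_def)
    then show ?thesis
      using p \<nu> le[OF t(1)] \<open>t * q < \<delta>\<close> by (intro bexI[of _ "\<nu> t"]) auto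
  qed
  have "metric_slope P2 wasserstein (\<lambda>v. enn2ereal (e v)) \<mu> = ennreal S"
  proof (rule metric_slope_eqI[where e = e and u = \<mu>, OF fin S0])
    fix \<epsilon> :: real assume \<epsilon>: "\<epsilon> > 0"
    \<comment> \<open>The error \<open>sqrt d * \<epsilon>\<close> becomes \<open>\<epsilon>\<close>
      at \<open>t = W / sqrt d\<close>, a choice admissible because
      \<open>SW \<le> W / sqrt d\<close>.\<close>
    obtain \<delta> where \<delta>: "\<delta> > 0" "\<And>\<nu> t. \<nu> \<in> P2 \<Longrightarrow> 0 < t \<Longrightarrow> t < \<delta> \<Longrightarrow> sliced_wasserstein \<mu> \<nu> \<le> t \<Longrightarrow>
        e \<mu> \<le> e \<nu> + ennreal ((sqrt d * S + sqrt d * \<epsilon>) * t)"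
      using upper[of "sqrt d * \<epsilon>"] d \<epsilon> by auto
    show "\<exists>\<delta>>0. \<forall>v\<in>P2. 0 < wasserstein \<mu> v \<longrightarrow> wasserstein \<mu> v < \<delta> \<longrightarrow>
        e \<mu> \<le> e v + ennreal ((S + \<epsilon>) * wasserstein \<mu> v)"
    proof (intro exI[of _ "sqrt d * \<delta>"] conjI ballI impI)
      fix v :: "'a measure"
      assume v: "v \<in> P2" "0 < wasserstein \<mu> v" "wasserstein \<mu> v < sqrt d * \<delta>"
      have "e \<mu> \<le> e v + ennreal ((sqrt d * S + sqrt d * \<epsilon>) * (wasserstein \<mu> v / sqrt d))"
        using v d sliced_wasserstein_le[OF P2 v(1)]
        by (intro \<delta>(2)) (auto simp: d_def pos_divide_less_eq mult.commute)
      also have "(sqrt d * S + sqrt d * \<epsilon>) * (wasserstein \<mu> v / sqrt d) = (S + \<epsilon>) * wasserstein \<mu> v"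
        using d by (simp add: field_simps)
      finally show "e \<mu> \<le> e v + ennreal ((S + \<epsilon>) * wasserstein \<mu> v)" .
    qed (use d \<delta> in simp)
  next
    fix c \<delta> :: real assume c: "0 < c" "c < S" and \<delta>: "0 < \<delta>"
    show "\<exists>v\<in>P2. 0 < wasserstein \<mu> v \<and> wasserstein \<mu> v < \<delta> \<and> e v + ennreal (c * wasserstein \<mu> v) \<le> e \<mu>"
    proof (rule lower[where dst = wasserstein and q = S, OF _ W_le _ _ c(1) \<delta>])
      fix \<nu> :: "'a measure" assume "\<nu> \<in> P2" "0 < sliced_wasserstein \<mu> \<nu>"
      then have "0 < wasserstein \<mu> \<nu> / sqrt DIM('a)"
        using sliced_wasserstein_le[OF P2] by (blast intro: less_le_trans)
      then show "0 < wasserstein \<mu> \<nu>" by (simp add: zero_less_divide_iff)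
    qed (use c in \<open>auto simp: power2_eq_square\<close>)
  qed
  moreover have "metric_slope P2 sliced_wasserstein (\<lambda>v. enn2ereal (e v)) \<mu> = ennreal (sqrt d * S)"
  proof (rule metric_slope_eqI[where e = e and u = \<mu>, OF fin])
    show "\<exists>\<delta>>0. \<forall>v\<in>P2. 0 < sliced_wasserstein \<mu> v \<longrightarrow> sliced_wasserstein \<mu> v < \<delta> \<longrightarrow>
        e \<mu> \<le> e v + ennreal ((sqrt d * S + \<epsilon>) * sliced_wasserstein \<mu> v)" if "\<epsilon> > 0" for \<epsilon>
      using upper[OF that] by blast
  next
    fix c \<delta> :: real assume c: "0 < c" "c < sqrt d * S" and \<delta>: "0 < \<delta>"
    have "S > 0" using c d S0 by (cases "S = 0") auto
    show "\<exists>v\<in>P2. 0 < sliced_wasserstein \<mu> v \<and> sliced_wasserstein \<mu> v < \<delta> \<and>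
        e v + ennreal (c * sliced_wasserstein \<mu> v) \<le> e \<mu>"
    proof (rule lower[where dst = sliced_wasserstein and q = "S / sqrt d", OF _ _ _ _ c(1) \<delta>])
      show "sliced_wasserstein \<mu> (\<nu> t) \<le> t * (S / sqrt d)" if "t > 0" for t
      proof -
        have "sliced_wasserstein \<mu> (\<nu> t) \<le> wasserstein \<mu> (\<nu> t) / sqrt d"
          unfolding d_def by (rule sliced_wasserstein_le[OF P2 \<nu>])
        also have "\<dots> \<le> t * S / sqrt d"
          using W_le[OF that] d by (intro divide_right_mono) auto
        finally show ?thesis by simp
      qed
      show "c * (S / sqrt d) < S\<^sup>2"
        using mult_strict_right_mono[OF c(2) \<open>S > 0\<close>] d by (simp add: power2_eq_square field_simps)
    qed (use \<open>S > 0\<close> d in auto)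
  qed (use S0 d in simp)
  moreover have "potential_energy V = (\<lambda>v. enn2ereal (e v))"
    by (simp add: fun_eq_iff potential_energy_def e_def)
  ultimately show ?thesis
    using S0 unfolding \<mu>_def d_def by auto
qed

theorem proposition7p5:
  fixes V :: "real ^ 'd \<Rightarrow> real"
    and n :: nat and m :: "nat \<Rightarrow> real" and x :: "nat \<Rightarrow> real ^ 'd"
  assumes "CARD('d) \<ge> 2"
    and "continuously_differentiable V"
    and "\<And>y. 0 \<le> V y"
    and "\<And>i. i \<in> {1..n} \<Longrightarrow> 0 \<le> m i"
    and "(\<Sum>i=1..n. m i) = 1"
  shows "metric_slope P2 sliced_wasserstein (potential_energy V) (discrete_measure n m x) =
    ennreal (sqrt (real CARD('d))) *
      metric_slope P2 wasserstein (potential_energy V) (discrete_measure n m x)"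
  using metric_slopes_discrete_measure[OF assms(2-5), of x] by (auto simp: ennreal_mult)

end
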